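(* Let $\mathbb F=\mathbb F_q$ be the field of order $q=p^d$ for a prime $p$. Let $w$ be a primitive element of $\mathbb F$ and $a$ the automorphism of $\mathbb F$ such that $w^a=w^p$. Let $G=G_0\ltimes\mathbb F^+\leqslant\operatorname{A\Gamma L}_1(q)$ be a one-dimensional affine group acting on $\mathbb F$ as a rank $4$ group and maximal with respect to this property. Then $G_0$ is conjugate in $\operatorname{\Gamma L}_1(q)=\langle a,w\rangle$ to exactly one of the following subgroups: (1) $\langle a,w^r\rangle$, where $r\in\pi(q-1)\setminus\{2\}$ and $\operatorname{ord}_r(p)=\frac{r-1}2$; (2) $\langle a^2,w^r\rangle$, where $r\in\pi(q-1)\setminus\{2\}$ and $\operatorname{ord}_r(p)=r-1$; (3) $\langle a,w^{r^2}\rangle$, where $r\in\pi(q-1)$, $r^2$ divides $q-1$, and $\operatorname{ord}_{r^2}(p)=r^2-r$; (4) $\langle aw^r,w^{2r}\rangle$, where $r\in\pi(q-1)\setminus\{2\}$ and $\operatorname{ord}_r(p)=r-1$, provided $p$ is odd.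
   Context: $\mathbb F^+$ is the additive group of $\mathbb F$, acting on $\mathbb F$ by translations; $\operatorname{\Gamma L}_1(q)=\langle a\rangle\ltimes\mathbb F^*$ acts on $\mathbb F$, where an element of $\mathbb F^*$ (in particular $w$) acts by multiplication and $a$ is the Frobenius map $x\mapsto x^p$ (permutations act on the right, so $aw$ is $x\mapsto x^pw$); $\operatorname{A\Gamma L}_1(q)=\operatorname{\Gamma L}_1(q)\ltimes\mathbb F^+$. A one-dimensional affine group is a subgroup $G\leqslant\operatorname{A\Gamma L}_1(q)$ containing $\mathbb F^+$, i.e. $G=G_0\ltimes\mathbb F^+$, where $G_0\leqslant\operatorname{\Gamma L}_1(q)$ is the stabilizer of $0$. A rank $4$ group is a transitive permutation group having exactly $4$ orbits on $\mathbb F\times\mathbb F$. Maximality is with respect to inclusion among the one-dimensional affine groups in $\operatorname{A\Gamma L}_1(q)$ of rank $4$. $\pi(m)$ is the set of prime divisors of $m$; $\operatorname{ord}_m(k)$ is the multiplicative order of $k$ modulo $m$ for coprime $m,k$. *)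

theory Defs
  imports
    "HOL-Algebra.Group_Action"
    "HOL-Algebra.Generated_Groups"
    "HOL-Number_Theory.Number_Theory"
    "HOL-Library.Cardinality"
begin

text \<open>
  Permutations of the field are elements of \<open>BijGroup UNIV\<close>, whose product is \<open>g \<otimes> f = g \<circ> f\<close>
  (maps on the left). With permutations acting on the right, the product written \<open>aw\<close> is
  \<open>x \<mapsto> x\<^sup>p w\<close>, that is, \<open>scaling w \<otimes> frob p\<close> here. Subgroups, generated
  subgroups, conjugacy classes of subgroups and orbits do not depend on this choice of side.
\<close>

abbreviation Perm :: "('a \<Rightarrow> 'a) monoid"
  where "Perm \<equiv> BijGroup UNIV"

definition frob :: "nat \<Rightarrow> 'a::{field,finite} \<Rightarrow> 'a"
  where "frob p = (\<lambda>x. x ^ p)"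

definition scaling :: "'a::{field,finite} \<Rightarrow> 'a \<Rightarrow> 'a"
  where "scaling c = (\<lambda>x. x * c)"

definition translation :: "'a::{field,finite} \<Rightarrow> 'a \<Rightarrow> 'a"
  where "translation c = (\<lambda>x. x + c)"

definition mult_group :: "('a::{field,finite} \<Rightarrow> 'a) set"
  where "mult_group = scaling ` (UNIV - {0})"

definition add_group :: "('a::{field,finite} \<Rightarrow> 'a) set"
  where "add_group = range translation"

text \<open>
  The semidirect products are internal ones, in which the two factors generate the whole group.
  The parameter \<open>p\<close> is the characteristic.
\<close>

definition GammaL1 :: "nat \<Rightarrow> ('a::{field,finite} \<Rightarrow> 'a) set"
  where "GammaL1 p = generate Perm ({frob p} \<union> mult_group)"

definition AGammaL1 :: "nat \<Rightarrow> ('a::{field,finite} \<Rightarrow> 'a) set"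
  where "AGammaL1 p = generate Perm (GammaL1 p \<union> add_group)"

definition primitive_element :: "'a::{field,finite} \<Rightarrow> bool"
  where "primitive_element w \<longleftrightarrow> range (\<lambda>k::nat. w ^ k) = UNIV - {0}"

definition one_dim_affine :: "nat \<Rightarrow> ('a::{field,finite} \<Rightarrow> 'a) set \<Rightarrow> bool"
  where "one_dim_affine p G \<longleftrightarrow>
    subgroup G Perm \<and> G \<subseteq> AGammaL1 p \<and> add_group \<subseteq> G"

definition point_stabilizer :: "('a \<Rightarrow> 'a) set \<Rightarrow> 'a \<Rightarrow> ('a \<Rightarrow> 'a) set"
  where "point_stabilizer G x = stabilizer (Perm\<lparr>carrier := G\<rparr>) (\<lambda>g. g) x"

definition has_rank :: "('a \<Rightarrow> 'a) set \<Rightarrow> nat \<Rightarrow> bool"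
  where "has_rank G k \<longleftrightarrow>
    transitive_action (Perm\<lparr>carrier := G\<rparr>) UNIV (\<lambda>g. g) \<and>
    card (orbits (Perm\<lparr>carrier := G\<rparr>) (UNIV \<times> UNIV) (\<lambda>g. map_prod g g)) = k"

definition maximal_rank4_affine :: "nat \<Rightarrow> ('a::{field,finite} \<Rightarrow> 'a) set \<Rightarrow> bool"
  where "maximal_rank4_affine p G \<longleftrightarrow>
    one_dim_affine p G \<and> has_rank G 4 \<and>
    (\<forall>H. one_dim_affine p H \<and> has_rank H 4 \<and> G \<subseteq> H \<longrightarrow> H = G)"

definition conjugate_in :: "('a \<Rightarrow> 'a) set \<Rightarrow> ('a \<Rightarrow> 'a) set \<Rightarrow> ('a \<Rightarrow> 'a) set \<Rightarrow> bool"
  where "conjugate_in L H K \<longleftrightarrow>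
    (\<exists>g\<in>L. K = g <#\<^bsub>Perm\<^esub> H #>\<^bsub>Perm\<^esub> (inv\<^bsub>Perm\<^esub> g))"

end

theory Submission
  imports Defs
begin

text \<open>
  Write the nonzero elements of the field as powers of \<open>w\<close>. A subgroup \<open>G0\<close> of \<open>GammaL1 p\<close> is
  generated by some \<open>x \<mapsto> x ^ (p ^ e) * w ^ s\<close> and \<open>x \<mapsto> x * w ^ n\<close> with \<open>n\<close> dividing \<open>q - 1\<close>, so its
  orbits on nonzero elements are the cycles of the affine map \<open>f x = k * x + s\<close> on the residues
  modulo \<open>n\<close>, where \<open>k = p ^ e\<close>. Rank 4 means that there are three cycles.

  The displacement of the \<open>i\<close>-th iterate of \<open>f\<close> is \<open>(1 + k + \<dots> + k ^ (i - 1)) * ((k - 1) * x + s)\<close>,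
  so the length of the cycle of \<open>x\<close> depends only on \<open>gcd ((k - 1) * x + s) n\<close>. If \<open>f\<close> has three
  cycles, the primes \<open>r\<close> dividing \<open>n\<close> modulo which \<open>f\<close> has a fixed point are few, since a fixed point
  modulo \<open>m\<close> gives at least one cycle for every divisor of \<open>m\<close>. Counting cycles of equal length then
  shows that \<open>f\<close> has three cycles already modulo \<open>r\<close>, \<open>r\<^sup>2\<close> or \<open>2 * r\<close> for such a prime \<open>r\<close>. After
  conjugation by a scaling that moves the fixed point to \<open>0\<close>, \<open>G0\<close> lies in one of the listed groups;
  maximality gives equality. The listed groups are told apart by the scalings that they contain
  and by the order of \<open>p\<close> modulo \<open>r\<close>.
\<close>

section \<open>Cycles of affine maps on residues\<close>

definition geo :: "nat \<Rightarrow> nat \<Rightarrow> nat"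
  where "geo k i = (\<Sum>j<i. k ^ j)"

lemma geo_0 [simp]: "geo k 0 = 0"
  by (simp add: geo_def)

lemma geo_Suc: "geo k (Suc i) = geo k i + k ^ i"
  by (simp add: geo_def)

lemma geo_1 [simp]: "geo k (Suc 0) = 1"
  by (simp add: geo_def)

lemma geo_add: "geo k (i + j) = geo k i + k ^ i * geo k j"
  by (induction j) (simp_all add: geo_Suc algebra_simps power_add)

lemma geo_mult: "geo k (i * j) = geo k i * geo (k ^ i) j"
proof (induction j)
  case (Suc j)
  have "geo k (i * Suc j) = geo k (i * j + i)" by (simp add: add.commute)
  then show ?case unfolding geo_add Suc.IH by (simp add: geo_Suc power_mult algebra_simps)
qed simp

lemma geo_eq_power: "k > 0 \<Longrightarrow> (k - 1) * geo k i + 1 = k ^ i"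
  by (induction i) (cases k; simp add: geo_Suc algebra_simps)+

lemma geo_cong: "[k = k'] (mod m) \<Longrightarrow> [geo k i = geo k' i] (mod m)"
  unfolding geo_def by (intro cong_sum cong_pow)

lemma geo_cong_1:
  assumes "[k = 1] (mod m)"
  shows "[geo k i = i] (mod m)"
  using geo_cong[OF assms, of i] by (simp add: geo_def)

text \<open>Each factor 3 of the length splits off as
  \<open>geo k (3 * i') = geo k 3 * geo (k ^ 3) i'\<close>, and \<open>geo k 3\<close> has exactly
  one factor 3 because \<open>k\<close> is 1 modulo 3. So the sum has no more factors 3 than its
  length.\<close>

lemma geo_3_dvd:
  assumes "[k = 1] (mod 3)" "3 ^ j dvd geo k i"
  shows "3 ^ j dvd i"
  using assms
proof (induction j arbitrary: k i)
  case (Suc j)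
  have "3 dvd geo k i" using Suc.prems(2) by (auto elim: dvd_mult_left)
  then have "3 dvd i"
    using geo_cong_1[OF Suc.prems(1), of i] by (simp add: cong_dvd_iff)
  then obtain i' where i: "i = 3 * i'" by blast
  have g: "geo k i = geo k 3 * geo (k ^ 3) i'" unfolding i by (rule geo_mult)
  have "\<exists>y. k = 3 * y + 1" using Suc.prems(1)
    unfolding cong_def by presburger
  then obtain y where k: "k = 3 * y + 1" by blast
  have "geo k 3 = 3 * (3 * y * y + 3 * y + 1)"
    by (simp add: k geo_def numeral_3_eq_3 algebra_simps power2_eq_square)
  moreover have "coprime (3 ^ j) (3 * y * y + 3 * y + 1)"
  proof -
    have "coprime 3 (3 * (y * y + y) + 1)"
      by (metis coprime_1_right coprime_iff_gcd_eq_1 gcd_add_mult mult.commute)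
    then show ?thesis by (simp add: algebra_simps)
  qed
  moreover have "3 ^ j dvd geo k 3 div 3 * geo (k ^ 3) i'"
  proof -
    have "3 * 3 ^ j dvd 3 * (geo k 3 div 3 * geo (k ^ 3) i')"
      using Suc.prems(2) g calculation(1)
      by (metis mult.assoc nonzero_mult_div_cancel_left power_Suc zero_neq_numeral)
    then show ?thesis by (subst (asm) nat_mult_dvd_cancel_disj) simp
  qed
  ultimately have "3 ^ j dvd geo (k ^ 3) i'"
    by (metis coprime_dvd_mult_right_iff nonzero_mult_div_cancel_left zero_neq_numeral)
  moreover have "[k ^ 3 = 1] (mod 3)" using cong_pow[OF Suc.prems(1), of 3] by simp
  ultimately have "3 ^ j dvd i'" using Suc.IH by blast
  then show ?case by (simp add: i)
qed simp

text \<open>The closed form of the \<open>i\<close>-th iterate of \<open>x \<mapsto> k * x + s\<close>.\<close>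

definition aff :: "nat \<Rightarrow> nat \<Rightarrow> nat \<Rightarrow> nat \<Rightarrow> nat"
  where "aff k s i x = k ^ i * x + s * geo k i"

section \<open>Cycles of an affine map and their lengths\<close>

definition aorb :: "nat \<Rightarrow> nat \<Rightarrow> nat \<Rightarrow> nat \<Rightarrow> nat set"
  where "aorb k s n x = range (\<lambda>i. aff k s i x mod n)"

definition norb :: "nat \<Rightarrow> nat \<Rightarrow> nat \<Rightarrow> nat"
  where "norb k s n = card (aorb k s n ` {..<n})"

lemma aff_0 [simp]: "aff k s 0 x = x"
  by (simp add: aff_def)

lemma aff_add: "aff k s (i + j) x = aff k s i (aff k s j x)"
  by (simp add: aff_def geo_add power_add algebra_simps)

text \<open>The first step moves \<open>x\<close> by \<open>(k - 1) * x + s\<close> and each further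
  step by \<open>k\<close> times the previous displacement; together they form a geometric
  sum.\<close>

lemma aff_displacement:
  assumes "k > 0"
  shows "aff k s i x = x + geo k i * ((k - 1) * x + s)"
  unfolding aff_def geo_eq_power[OF assms, symmetric] by (simp add: algebra_simps)

lemma aff_cong: "[x = y] (mod n) \<Longrightarrow> [aff k s i x = aff k s i y] (mod n)"
  unfolding aff_def by (intro cong_add cong_mult cong_refl)

lemma aff_cong_iff:
  assumes "coprime k n"
  shows "[aff k s i x = aff k s i y] (mod n) \<longleftrightarrow> [x = y] (mod n)"
  using assms by (simp add: aff_def cong_add_rcancel_nat cong_mult_lcancel_nat)

lemma aorb_mod [simp]: "aorb k s n (x mod n) = aorb k s n x"
  unfolding aorb_def using aff_cong[of "x mod n" x n k s] by (simp add: cong_def)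

lemma aorb_cong: "[x = y] (mod n) \<Longrightarrow> aorb k s n x = aorb k s n y"
  using aorb_mod by (metis cong_def)

lemma aorb_subset: "n > 0 \<Longrightarrow> aorb k s n x \<subseteq> {..<n}"
  by (auto simp: aorb_def)

lemma finite_aorb: "n > 0 \<Longrightarrow> finite (aorb k s n x)"
  by (rule finite_subset[OF aorb_subset finite_lessThan])

lemma aorb_self: "x mod n \<in> aorb k s n x"
  unfolding aorb_def by (metis aff_0 rangeI)

text \<open>Two iterates coincide by the pigeonhole principle, and the earlier one cancels because
  \<open>k\<close> is a unit modulo \<open>n\<close>.\<close>

lemma aff_period:
  assumes "n > 0" "coprime k n"
  shows "\<exists>P>0. [aff k s P x = x] (mod n)"
proof -
  have "\<not> inj_on (\<lambda>i. aff k s i x mod n) UNIV"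
    using finite_aorb[OF assms(1), of k s x] unfolding aorb_def
    by (meson finite_imageD infinite_UNIV_nat)
  then obtain i j where ij: "aff k s i x mod n = aff k s j x mod n" "i < j"
    unfolding inj_on_def by (metis linorder_neqE_nat)
  have "[aff k s i (aff k s (j - i) x) = aff k s i x] (mod n)"
    using ij by (simp add: cong_def flip: aff_add)
  then show ?thesis using ij assms by (auto simp: aff_cong_iff intro!: exI[of _ "j - i"])
qed

text \<open>Orbits consist of forward iterates only; periodicity provides the way back from
  \<open>y\<close> to \<open>x\<close>.\<close>

lemma aorb_eq:
  assumes "n > 0" "coprime k n" "y mod n \<in> aorb k s n x"
  shows "aorb k s n y = aorb k s n x"
proof -
  have sub: "aorb k s n v \<subseteq> aorb k s n u" if vu: "v mod n \<in> aorb k s n u" for u v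
  proof
    fix z assume "z \<in> aorb k s n v"
    then obtain i where z: "z = aff k s i v mod n" by (auto simp: aorb_def)
    obtain j where "[v = aff k s j u] (mod n)" using vu by (auto simp: aorb_def cong_def)
    then have "[aff k s i v = aff k s (i + j) u] (mod n)" by (simp add: aff_add aff_cong)
    then show "z \<in> aorb k s n u" unfolding z aorb_def by (auto simp: cong_def)
  qed
  obtain j where j: "[y = aff k s j x] (mod n)" using assms(3) by (auto simp: aorb_def cong_def)
  obtain P where P: "P > 0" "[aff k s P x = x] (mod n)" using aff_period assms by blast
  have m: "[aff k s (P * i) x = x] (mod n)" for i
  proof (induction i)
    case (Suc i)
    have "[aff k s P (aff k s (P * i) x) = x] (mod n)"
      using Suc P(2) cong_trans aff_cong by blast
    then show ?case by (simp add: aff_add)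
  qed simp
  \<comment> \<open>\<open>P * j\<close> is a multiple of the period \<open>P\<close> and at least
    \<open>j\<close>, so \<open>P * j - j\<close> further steps lead from \<open>y\<close> to
    \<open>x\<close>.\<close>
  have "j \<le> P * j" using P by simp
  then have "[aff k s (P * j - j) y = x] (mod n)"
    using cong_trans[OF aff_cong[OF j, of k s "P * j - j"]] m[of j] by (simp flip: aff_add)
  then have "x mod n \<in> aorb k s n y" unfolding aorb_def cong_def by (metis rangeI)
  then show ?thesis using sub assms(3) by blast
qed

lemma aorb_eq_iff:
  assumes "n > 0" "coprime k n"
  shows "aorb k s n x = aorb k s n y \<longleftrightarrow> (\<exists>i. [aff k s i x = y] (mod n))"
proof
  assume "aorb k s n x = aorb k s n y"
  then have "y mod n \<in> aorb k s n x" using aorb_self by blast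
  then show "\<exists>i. [aff k s i x = y] (mod n)" by (auto simp: aorb_def cong_def)
next
  assume "\<exists>i. [aff k s i x = y] (mod n)"
  then have "y mod n \<in> aorb k s n x" unfolding aorb_def cong_def by (metis rangeI)
  then show "aorb k s n x = aorb k s n y" using aorb_eq[OF assms] by blast
qed

definition per :: "nat \<Rightarrow> nat \<Rightarrow> nat \<Rightarrow> nat \<Rightarrow> nat"
  where "per k s n x = (LEAST i. i > 0 \<and> [aff k s i x = x] (mod n))"

lemma per:
  assumes "n > 0" "coprime k n"
  shows "per k s n x > 0" "[aff k s (per k s n x) x = x] (mod n)"
  using LeastI_ex[OF aff_period[OF assms], of s x] by (auto simp: per_def)

lemma per_le: "i > 0 \<Longrightarrow> [aff k s i x = x] (mod n) \<Longrightarrow> per k s n x \<le> i"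
  unfolding per_def by (intro Least_le conjI)

lemma card_aorb:
  assumes "n > 0" "coprime k n"
  shows "card (aorb k s n x) = per k s n x"
proof -
  let ?P = "per k s n x"
  have red: "[aff k s (?P * i) x = x] (mod n)" for i
  proof (induction i)
    case (Suc i)
    have "[aff k s ?P (aff k s (?P * i) x) = x] (mod n)"
      using Suc per(2)[OF assms] cong_trans aff_cong by blast
    then show ?case by (simp add: aff_add)
  qed simp
  have "aff k s i x mod n = aff k s (i mod ?P) x mod n" for i
  proof -
    have "[aff k s (i mod ?P) (aff k s (?P * (i div ?P)) x) = aff k s (i mod ?P) x] (mod n)"
      by (intro aff_cong red)
    then show ?thesis by (simp add: cong_def flip: aff_add)
  qed
  then have "aorb k s n x = (\<lambda>i. aff k s i x mod n) ` {..<?P}"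
    unfolding aorb_def using per(1)[OF assms] by (fastforce simp: image_iff)
  moreover have "inj_on (\<lambda>i. aff k s i x mod n) {..<?P}"
  proof (rule linorder_inj_onI)
    fix i j assume ij: "i < j" "i \<in> {..<?P}" "j \<in> {..<?P}"
    show "aff k s i x mod n \<noteq> aff k s j x mod n"
    proof
      assume "aff k s i x mod n = aff k s j x mod n"
      then have "[aff k s i (aff k s (j - i) x) = aff k s i x] (mod n)"
        using ij by (simp add: cong_def flip: aff_add)
      then show False using per_le[of "j - i" k s x n] ij assms by (auto simp: aff_cong_iff)
    qed
  qed auto
  ultimately show ?thesis by (simp add: card_image)
qed

lemma aff_fixed_iff:
  assumes "k > 0"
  shows "[aff k s i x = x] (mod n) \<longleftrightarrow> n dvd geo k i * ((k - 1) * x + s)"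
proof -
  have "[x + geo k i * ((k - 1) * x + s) = x + 0] (mod n) \<longleftrightarrow> [geo k i * ((k - 1) * x + s) = 0] (mod n)"
    by (rule cong_add_lcancel_nat)
  then show ?thesis by (simp add: aff_displacement[OF assms] cong_0_iff)
qed

text \<open>By the displacement formula, \<open>x\<close> returns after \<open>i\<close> steps iff
  \<open>n\<close> divides \<open>geo k i\<close> times the first displacement. Only the gcd of that
  displacement with \<open>n\<close> matters.\<close>

lemma card_aorb_gcd:
  assumes "n > 0" "coprime k n" "k > 0"
    and "gcd ((k - 1) * x + s) n = gcd ((k - 1) * y + s) n"
  shows "card (aorb k s n x) = card (aorb k s n y)"
proof -
  have *: "n dvd c * u \<longleftrightarrow> n dvd c * gcd u n" for c u :: nat
    by (metis dvd_triv_right gcd_greatest_iff gcd_mult_distrib_nat)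
  have "[aff k s i x = x] (mod n) \<longleftrightarrow> [aff k s i y = y] (mod n)" for i
    unfolding aff_fixed_iff[OF assms(3)] using assms(4) by (subst (1 2) *) simp
  then show ?thesis by (simp add: card_aorb assms per_def)
qed

section \<open>Counting the cycles of an affine map\<close>

lemma aorb_image_lessThan:
  assumes "n > 0"
  shows "aorb k s n ` {..<n} = range (aorb k s n)"
proof
  show "range (aorb k s n) \<subseteq> aorb k s n ` {..<n}"
  proof
    fix X assume "X \<in> range (aorb k s n)"
    then obtain x where "X = aorb k s n x" by (rule rangeE)
    then have "X = aorb k s n (x mod n)" by (simp only: aorb_mod)
    moreover have "x mod n \<in> {..<n}" using assms by simp
    ultimately show "X \<in> aorb k s n ` {..<n}" by (rule image_eqI)
  qed
  show "aorb k s n ` {..<n} \<subseteq> range (aorb k s n)"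
    by (rule image_mono[OF subset_UNIV])
qed

lemma norb_cong: "[s = s'] (mod n) \<Longrightarrow> norb k s n = norb k s' n"
proof -
  assume "[s = s'] (mod n)"
  then have "aff k s i x mod n = aff k s' i x mod n" for i x
    unfolding aff_def cong_def[symmetric] by (intro cong_add cong_mult cong_refl)
  then show ?thesis unfolding norb_def aorb_def by simp
qed

text \<open>Reduction modulo \<open>m\<close> maps the cycles modulo \<open>n\<close> onto those
  modulo \<open>m\<close>.\<close>

lemma norb_mono:
  assumes "m dvd n" "n > 0"
  shows "norb k s m \<le> norb k s n"
proof -
  have m: "m > 0" using assms by (auto intro: Nat.gr0I)
  have "(\<lambda>z. z mod m) ` aorb k s n x = aorb k s m x" for x
    using assms(1) by (simp add: aorb_def image_image mod_mod_cancel)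
  then have "aorb k s m ` {..<m} = (\<lambda>X. (\<lambda>z. z mod m) ` X) ` (aorb k s n ` {..<n})"
    by (simp add: aorb_image_lessThan m assms(2) image_image)
  then show ?thesis unfolding norb_def by (simp add: card_image_le)
qed

text \<open>Substituting \<open>t + y\<close> for \<open>x\<close> turns the constant
  \<open>s\<close> into \<open>s + (k - 1) * t\<close>, so translation by \<open>t\<close> carries
  the cycles of the new map onto those of the old one.\<close>

lemma norb_translate_le:
  assumes "n > 0" "k > 0"
  shows "norb k s n \<le> norb k (s + (k - 1) * t) n"
proof -
  let ?s = "s + (k - 1) * t" and ?h = "\<lambda>X. (\<lambda>z. (t + z) mod n) ` X"
  have "aff k s i (t + y) = t + aff k ?s i y" for i y
    unfolding aff_displacement[OF assms(2)] using assms(2) by (cases k) (simp_all add: algebra_simps)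
  then have *: "aorb k s n (t + y) = ?h (aorb k ?s n y)" for y
    by (simp add: aorb_def image_image mod_add_right_eq)
  have "aorb k s n x \<in> ?h ` range (aorb k ?s n)" for x
  proof -
    \<comment> \<open>\<open>x + (n - 1) * t\<close> represents \<open>x - t\<close> modulo
      \<open>n\<close>.\<close>
    have "t + (x + (n - 1) * t) = x + n * t" using assms(1) by (cases n) simp_all
    then have "[x = t + (x + (n - 1) * t)] (mod n)" by (simp only: cong_def mod_mult_self2)
    then have "aorb k s n x = ?h (aorb k ?s n (x + (n - 1) * t))"
      unfolding *[symmetric] by (rule aorb_cong)
    then show ?thesis by (rule image_eqI) (rule rangeI)
  qed
  then have "aorb k s n ` {..<n} \<subseteq> ?h ` (aorb k ?s n ` {..<n})"
    unfolding aorb_image_lessThan[OF assms(1)] by blast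
  then have "card (aorb k s n ` {..<n}) \<le> card (?h ` (aorb k ?s n ` {..<n}))"
    by (intro card_mono) simp_all
  also have "\<dots> \<le> card (aorb k ?s n ` {..<n})" by (intro card_image_le) simp
  finally show ?thesis by (simp add: norb_def)
qed

lemma norb_translate:
  assumes "n > 0" "k > 0"
  shows "norb k (s + (k - 1) * t) n = norb k s n"
proof (rule antisym)
  let ?s = "s + (k - 1) * t + (k - 1) * ((n - 1) * t)"
  have "?s = s + n * ((k - 1) * t)" using assms by (cases n; cases k) (simp_all add: algebra_simps)
  then have "[?s = s] (mod n)" by (simp only: cong_def mod_mult_self2)
  then show "norb k (s + (k - 1) * t) n \<le> norb k s n"
    using norb_translate_le[OF assms, of "s + (k - 1) * t" "(n - 1) * t"] norb_cong by metis
qed (rule norb_translate_le[OF assms])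

lemma gcd_aorb_0:
  assumes "n > 0" "coprime k n" "aorb k 0 n x = aorb k 0 n y"
  shows "gcd x n = gcd y n"
proof -
  obtain i where "[k ^ i * x = y] (mod n)"
    using aorb_eq_iff[of n k 0 x y] assms by (auto simp: aff_def)
  then have "gcd (k ^ i * x) n = gcd y n" by (rule cong_gcd_eq)
  then show ?thesis using assms(2) by (simp add: gcd_mult_left_left_cancel coprime_commute)
qed

text \<open>The divisibility hypothesis says that \<open>t\<close> is a fixed point modulo
  \<open>n\<close>. Moving it to 0 leaves multiplication by the unit \<open>k\<close>, which
  preserves gcds with \<open>n\<close>, so distinct divisors of \<open>n\<close> lie on distinct
  cycles.\<close>

lemma card_divisors_le_norb:
  assumes "n > 0" "k > 0" "coprime k n" "n dvd s + (k - 1) * t"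
  shows "card {d. d dvd n} \<le> norb k s n"
proof -
  have "inj_on (aorb k 0 n) {d. d dvd n}"
    using gcd_aorb_0[OF assms(1,3)] by (intro inj_onI) (metis gcd_nat.absorb1 mem_Collect_eq)
  then have "card {d. d dvd n} = card (aorb k 0 n ` {d. d dvd n})" by (simp add: card_image)
  also have "\<dots> \<le> norb k 0 n"
  proof -
    have "aorb k 0 n ` {d. d dvd n} \<subseteq> aorb k 0 n ` {..<n}"
      unfolding aorb_image_lessThan[OF assms(1)] by blast
    then show ?thesis unfolding norb_def by (simp add: card_mono)
  qed
  also have "\<dots> = norb k (s + (k - 1) * t) n"
    using assms(4) by (intro norb_cong) (metis cong_0_iff cong_sym)
  finally show ?thesis by (simp only: norb_translate[OF assms(1,2)])
qed

lemma card_invariant: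
  assumes "n > 0" "coprime k n" "A \<subseteq> {..<n}"
    and "\<And>x. x \<in> A \<Longrightarrow> aorb k s n x \<subseteq> A" "\<And>x. x \<in> A \<Longrightarrow> card (aorb k s n x) = L"
  shows "card A = L * card (aorb k s n ` A)"
proof -
  have U: "\<Union> (aorb k s n ` A) = A"
  proof
    show "A \<subseteq> \<Union> (aorb k s n ` A)"
    proof
      fix x assume "x \<in> A"
      moreover have "x mod n = x" using assms(3) \<open>x \<in> A\<close> by auto
      ultimately show "x \<in> \<Union> (aorb k s n ` A)" using aorb_self[of x n k s] by auto
    qed
  qed (use assms(4) in blast)
  have fin: "finite A" using assms(3) finite_subset by blast
  have "L * card (aorb k s n ` A) = card (\<Union> (aorb k s n ` A))"
  proof (rule card_partition)
    fix X Y assume XY: "X \<in> aorb k s n ` A" "Y \<in> aorb k s n ` A" "X \<noteq> Y"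
    show "X \<inter> Y = {}"
    proof (rule ccontr)
      assume "X \<inter> Y \<noteq> {}"
      then obtain z where z: "z \<in> X" "z \<in> Y" by blast
      have "aorb k s n z = aorb k s n x" if "z \<in> aorb k s n x" for x
        using aorb_eq[OF assms(1,2)] aorb_subset[OF assms(1), of k s x] that by fastforce
      then show False using XY z by auto
    qed
  qed (use U fin assms(5) in auto)
  then show ?thesis by (simp add: U)
qed

text \<open>Invariance under one step passes to whole cycles, so no cycle meets both classes and the
  counts add up.\<close>

lemma norb_split:
  assumes "n > 0" "coprime k n" "\<And>x y. [aff k s 1 x = y] (mod n) \<Longrightarrow> P x = P y"
  shows "norb k s n = card (aorb k s n ` {x. x < n \<and> P x}) + card (aorb k s n ` {x. x < n \<and> \<not> P x})"
    and "x < n \<Longrightarrow> y \<in> aorb k s n x \<Longrightarrow> y < n \<and> (P y \<longleftrightarrow> P x)"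
proof -
  have inv: "P x = P y" if "[aff k s i x = y] (mod n)" for i x y
    using that
  proof (induction i arbitrary: y)
    \<comment> \<open>Here \<open>x\<close> and \<open>y\<close> are only congruent; both take one
      step to the same residue, and \<open>P\<close> is compared there.\<close>
    case 0
    moreover have "[aff k s 1 x = aff k s 1 y] (mod n)" using 0 by (intro aff_cong) simp
    ultimately show ?case using assms(3) by (metis cong_refl)
  next
    case (Suc i)
    have "[aff k s 1 (aff k s i x) = y] (mod n)" using Suc.prems by (simp flip: aff_add)
    then show ?case using Suc.IH[of "aff k s i x"] assms(3) by auto
  qed
  let ?A = "{x. x < n \<and> P x}" and ?B = "{x. x < n \<and> \<not> P x}"
  have "{..<n} = ?A \<union> ?B" by auto
  then have "norb k s n = card (aorb k s n ` ?A \<union> aorb k s n ` ?B)"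
    unfolding norb_def by (metis image_Un)
  also have "\<dots> = card (aorb k s n ` ?A) + card (aorb k s n ` ?B)"
  proof (rule card_Un_disjoint)
    show "aorb k s n ` ?A \<inter> aorb k s n ` ?B = {}"
      using aorb_eq_iff[OF assms(1,2)] inv by fastforce
  qed auto
  finally show "norb k s n = card (aorb k s n ` ?A) + card (aorb k s n ` ?B)" .
  show "x < n \<Longrightarrow> y \<in> aorb k s n x \<Longrightarrow> y < n \<and> (P y \<longleftrightarrow> P x)"
    using inv[of _ x y] aorb_subset[OF assms(1), of k s x] unfolding aorb_def cong_def
    by (auto simp: assms(1))
qed

text \<open>A unit \<open>x\<close> can be cancelled from \<open>k ^ i * x = x\<close>, so every
  cycle of units has length \<open>ord n k\<close>; \<open>c\<close> is the number of these
  cycles.\<close>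

lemma units_orbits:
  assumes "n > 0" "coprime k n"
  obtains c where "c * ord n k = totient n"
    "norb k 0 n = c + card (aorb k 0 n ` {x. x < n \<and> \<not> coprime x n})"
proof
  have P: "coprime x n = coprime y n" if "[aff k 0 1 x = y] (mod n)" for x y
    using that assms(2) by (simp add: aff_def) (metis cong_imp_coprime cong_sym coprime_mult_left_iff)
  note split = norb_split[OF assms, of 0 "\<lambda>x. coprime x n", OF P]
  let ?C = "{x. x < n \<and> coprime x n}"
  show "norb k 0 n = card (aorb k 0 n ` ?C) + card (aorb k 0 n ` {x. x < n \<and> \<not> coprime x n})"
    by (rule split(1))
  have "card ?C = totient n"
  proof (cases "n = 1")
    \<comment> \<open>Modulo 1 the only residue is 0, whereas \<open>totatives 1\<close> contains
      1.\<close>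
    case True
    then have "?C = {0}" by auto
    then show ?thesis using True by simp
  next
    case False
    then have "?C = totatives n" using assms(1)
      by (auto simp: totatives_def intro!: Nat.gr0I intro: le_neq_implies_less)
    then show ?thesis by (simp add: totient_def)
  qed
  moreover have "card ?C = ord n k * card (aorb k 0 n ` ?C)"
  proof (rule card_invariant[OF assms])
    fix x assume x: "x \<in> ?C"
    have "[aff k 0 i x = x] (mod n) \<longleftrightarrow> ord n k dvd i" for i
      using x cong_mult_rcancel_nat[of x n "k ^ i" 1] by (simp add: aff_def ord_divides')
    then have "per k 0 n x = (LEAST i. i > 0 \<and> ord n k dvd i)" by (simp add: per_def)
    also have "\<dots> = ord n k"
      using assms(2) by (intro Least_equality) (auto simp: coprime_commute dvd_imp_le)
    finally show "card (aorb k 0 n x) = ord n k" by (simp add: card_aorb assms)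
    show "aorb k 0 n x \<subseteq> ?C" using split(2) x by blast
  qed auto
  ultimately show "card (aorb k 0 n ` ?C) * ord n k = totient n" by (simp add: mult.commute)
qed

text \<open>The only non-unit is 0, which accounts for the extra cycle.\<close>

lemma norb_prime:
  assumes "prime r" "coprime k r"
  obtains c where "c * ord r k = r - 1" "norb k 0 r = c + 1"
proof -
  have r: "r > 0" using assms(1) prime_gt_0_nat by blast
  obtain c where c: "c * ord r k = totient r"
    "norb k 0 r = c + card (aorb k 0 r ` {x. x < r \<and> \<not> coprime x r})"
    using units_orbits[OF r assms(2)] by blast
  have "{x. x < r \<and> \<not> coprime x r} = {0}"
    using assms(1) r by (auto simp: prime_nat_iff'' coprime_commute)
  then show thesis using c that assms(1) by (simp add: totient_prime)
qed

text \<open>The non-units 0 and \<open>r\<close> lie on different cycles. At most three cycles leave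
  room for only one cycle of units, whose length is then the full totient.\<close>

lemma norb_prime_square:
  assumes "prime r" "coprime k r" "norb k 0 (r\<^sup>2) \<le> 3"
  shows "ord (r\<^sup>2) k = r\<^sup>2 - r"
proof -
  have r: "r\<^sup>2 > 0" "r > 1" using assms(1) prime_gt_1_nat by (auto simp: prime_gt_0_nat)
  have cop: "coprime k (r\<^sup>2)" using assms(2) by simp
  obtain c where c: "c * ord (r\<^sup>2) k = totient (r\<^sup>2)"
    "norb k 0 (r\<^sup>2) = c + card (aorb k 0 (r\<^sup>2) ` {x. x < r\<^sup>2 \<and> \<not> coprime x (r\<^sup>2)})"
    using units_orbits[OF r(1) cop] by blast
  have "aorb k 0 (r\<^sup>2) 0 \<noteq> aorb k 0 (r\<^sup>2) r"
    using gcd_aorb_0[OF r(1) cop, of 0 r] r by (auto simp: power2_eq_square)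
  then have "2 = card {aorb k 0 (r\<^sup>2) 0, aorb k 0 (r\<^sup>2) r}" by simp
  also have "\<dots> \<le> card (aorb k 0 (r\<^sup>2) ` {x. x < r\<^sup>2 \<and> \<not> coprime x (r\<^sup>2)})"
    using r by (intro card_mono) (auto simp: power2_eq_square)
  finally have "c \<le> 1" using c(2) assms(3) by simp
  moreover have "totient (r\<^sup>2) = r\<^sup>2 - r"
    using totient_prime_power[OF assms(1), of 2] by (simp add: power2_eq_square diff_mult_distrib2)
  moreover have "r\<^sup>2 - r > 0" using r by (simp add: power2_eq_square)
  ultimately show ?thesis using c(1) by (cases c) auto
qed

text \<open>The multiples of \<open>r\<close> and the other residues are invariant classes. The
  second has \<open>2 * (r - 1)\<close> elements, but the cycle of 1 has length at most
  \<open>r - 1\<close>, so at least two cycles lie there.\<close>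

lemma norb_double_prime:
  assumes "prime r" "odd r" "odd k" "coprime k r" "ord r k = r - 1"
  shows "norb k r (2 * r) \<ge> 3"
proof -
  let ?n = "2 * r"
  have r: "r > 2" using assms(1,2) prime_ge_2_nat[of r] by (cases "r = 2") auto
  have n: "?n > 0" using r by simp
  have cop: "coprime k ?n" using assms(3,4) by (simp add: coprime_commute)
  have P: "r dvd x \<longleftrightarrow> r dvd y" if "[aff k r 1 x = y] (mod ?n)" for x y
  proof -
    have "[k * x + r = y] (mod r)" using cong_dvd_modulus_nat[OF that, of r] by (simp add: aff_def)
    then have "r dvd k * x + r \<longleftrightarrow> r dvd y" by (rule cong_dvd_iff)
    then show ?thesis using assms(4) by (simp add: coprime_commute coprime_dvd_mult_right_iff)
  qed
  note split = norb_split[OF n cop, of r "\<lambda>x. r dvd x", OF P]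
  let ?A = "{x. x < ?n \<and> r dvd x}" and ?B = "{x. x < ?n \<and> \<not> r dvd x}"
  have "card (aorb k r ?n ` ?A) > 0" using n by (subst card_gt_0_iff) (auto intro: exI[of _ 0])
  moreover have "card (aorb k r ?n ` ?B) \<ge> 2"
  proof (rule ccontr)
    assume "\<not> ?thesis"
    then have le: "card (aorb k r ?n ` ?B) \<le> Suc 0" by simp
    have fin: "finite (aorb k r ?n ` ?B)" by simp
    have 1: "1 \<in> ?B" using r by auto
    \<comment> \<open>Modulo \<open>r\<close> this is the order of \<open>k\<close>; modulo 2,
      \<open>geo k (r - 1)\<close> is a sum of an even number of odd terms.\<close>
    have "[aff k r (r - 1) 1 = 1] (mod ?n)"
    proof -
      have "[k ^ (r - 1) + r * geo k (r - 1) = 1 + 0] (mod r)"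
        using ord[of k r] assms(5) by (intro cong_add) (auto simp: cong_0_iff)
      moreover have "[k ^ (r - 1) + r * geo k (r - 1) = 1] (mod 2)"
      proof -
        have "[geo k (r - 1) = r - 1] (mod 2)"
          using assms(3) by (intro geo_cong_1) (simp add: cong_def odd_iff_mod_2_eq_one)
        then have "even (geo k (r - 1)) \<longleftrightarrow> even (r - 1)" by (rule cong_dvd_iff)
        then have "odd (k ^ (r - 1) + r * geo k (r - 1))" using assms(2,3) r by simp
        then show ?thesis unfolding cong_def odd_iff_mod_2_eq_one by (simp only: one_mod_two_eq_one)
      qed
      ultimately have "[k ^ (r - 1) + r * geo k (r - 1) = 1] (mod 2 * r)"
        using coprime_cong_mult_nat assms(2) by (simp add: coprime_left_2_iff_odd)
      then show ?thesis by (simp add: aff_def)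
    qed
    then have "card (aorb k r ?n 1) \<le> r - 1"
      unfolding card_aorb[OF n cop] using r per_le[of "r - 1"] by simp
    moreover have "?B \<subseteq> aorb k r ?n 1"
    proof
      fix x assume x: "x \<in> ?B"
      have "aorb k r ?n x = aorb k r ?n 1"
        using le[unfolded card_le_Suc0_iff_eq[OF fin]] x 1 by blast
      then show "x \<in> aorb k r ?n 1" using aorb_self[of x ?n k r] x by simp
    qed
    moreover have "card ?B = 2 * (r - 1)"
    proof -
      have "?A = {0, r}" using r by (auto elim!: dvdE)
      then have "card ?A = 2" using r by simp
      moreover have "?B = {..<?n} - ?A" by blast
      moreover have "?A \<subseteq> {..<?n}" by blast
      ultimately show ?thesis by (simp add: card_Diff_subset)
    qed
    ultimately have "2 * (r - 1) \<le> r - 1"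
      by (metis card_mono finite_aorb le_trans n)
    then show False using r by simp
  qed
  ultimately show ?thesis using split(1) by simp
qed

lemma norb_half:
  assumes "prime r" "r \<noteq> 2" "coprime k r" "ord r k = (r - 1) div 2"
  shows "norb k 0 r = 3"
proof -
  obtain c where c: "c * ord r k = r - 1" "norb k 0 r = c + 1" using norb_prime[OF assms(1,3)] .
  have r: "r > 2" using assms(1,2) prime_ge_2_nat[of r] by simp
  have "odd r" using assms(1) r by (simp add: prime_odd_nat)
  then have h: "2 * ((r - 1) div 2) = r - 1" by simp
  then have "c * ((r - 1) div 2) = 2 * ((r - 1) div 2)" using c(1) assms(4) by simp
  moreover have "(r - 1) div 2 > 0" using h r by (intro Nat.gr0I) simp
  ultimately have "c = 2" by simp
  then show ?thesis using c(2) by simp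
qed

section \<open>Affine maps with three cycles\<close>

text \<open>Inverting \<open>k - 1\<close> modulo \<open>m\<close> solves
  \<open>(k - 1) * t = - s\<close>, with \<open>(m - 1) * s\<close> in the role of
  \<open>- s\<close>.\<close>

lemma fixed_point_exists:
  fixes k m s :: nat
  assumes "coprime (k - 1) m" "m > 0"
  shows "\<exists>t. m dvd s + (k - 1) * t"
proof -
  obtain u where "[(k - 1) * u = 1] (mod m)" using assms(1) cong_solve_coprime_nat by auto
  then have "[(k - 1) * u * ((m - 1) * s) = 1 * ((m - 1) * s)] (mod m)" by (rule cong_scalar_right)
  then have "[s + (k - 1) * (u * ((m - 1) * s)) = s + (m - 1) * s] (mod m)"
    by (intro cong_add cong_refl) (simp add: mult.assoc)
  moreover have "s + (m - 1) * s = m * s" using assms(2) by (cases m) simp_all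
  then have "m dvd s + (m - 1) * s" by simp
  ultimately show ?thesis using cong_dvd_iff by blast
qed

lemma card_residue_class:
  assumes "r > 0"
  shows "card {x. x < r * N \<and> [x = t] (mod r)} = N"
proof -
  have "{x. x < r * N \<and> [x = t] (mod r)} = (\<lambda>i. t mod r + r * i) ` {..<N}"
  proof (intro equalityI subsetI)
    fix x assume x: "x \<in> {x. x < r * N \<and> [x = t] (mod r)}"
    then have "x = t mod r + r * (x div r)" by (metis cong_def mem_Collect_eq mod_mult_div_eq)
    moreover have "x div r < N" using x by (simp add: less_mult_imp_div_less mult.commute)
    ultimately show "x \<in> (\<lambda>i. t mod r + r * i) ` {..<N}" by blast
  next
    fix x assume "x \<in> (\<lambda>i. t mod r + r * i) ` {..<N}"
    then obtain i where i: "x = t mod r + r * i" "i < N" by blast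
    have "t mod r + r * i < r * Suc i" using assms by simp
    also have "\<dots> \<le> r * N" using i(2) by (intro mult_le_mono) simp_all
    finally show "x \<in> {x. x < r * N \<and> [x = t] (mod r)}" using i(1) by (simp add: cong_def)
  qed
  moreover have "inj_on (\<lambda>i. t mod r + r * i) {..<N}" using assms by (simp add: inj_on_def)
  ultimately show ?thesis by (simp add: card_image)
qed

text \<open>All first displacements are coprime to \<open>n\<close>. Hence all cycles have one
  length \<open>L\<close>, so \<open>n = 3 * L\<close>, and \<open>n\<close> divides
  \<open>geo k L\<close>. By \<open>geo_3_dvd\<close>, \<open>L\<close> would have as many factors 3
  as \<open>3 * L\<close>.\<close>

lemma three_orbits_no_fixed_point:
  assumes n: "n > 0" and cop: "coprime k n" and k: "k > 0" and norb: "norb k s n = 3"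
    and nofix: "\<And>l t. prime l \<Longrightarrow> l dvd n \<Longrightarrow> \<not> l dvd s + (k - 1) * t"
  shows False
proof -
  have D: "gcd ((k - 1) * x + s) n = 1" for x
  proof (rule ccontr)
    assume "gcd ((k - 1) * x + s) n \<noteq> 1"
    then obtain l where "prime l" "l dvd gcd ((k - 1) * x + s) n" using prime_factor_nat by blast
    then show False using nofix[of l x] by (simp add: add.commute)
  qed
  define L where "L = card (aorb k s n 0)"
  have "card (aorb k s n x) = L" for x
    unfolding L_def by (rule card_aorb_gcd[OF n cop k]) (simp only: D)
  then have "card {..<n} = L * norb k s n" unfolding norb_def
    by (intro card_invariant[OF n cop] aorb_subset[OF n] order_refl)
  then have nL: "n = L * 3" by (simp add: norb)
  have "n dvd geo k L * ((k - 1) * 0 + s)"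
    unfolding aff_fixed_iff[OF k, symmetric] L_def card_aorb[OF n cop] by (rule per(2)[OF n cop])
  moreover have "coprime n s" using D[of 0]
    unfolding coprime_iff_gcd_eq_1 by (subst gcd.commute) (simp only: mult_0_right add_0)
  ultimately have ndvd: "n dvd geo k L" by (simp add: coprime_dvd_mult_left_iff)
  \<comment> \<open>3 divides \<open>n\<close>, and an invertible \<open>k - 1\<close> would give a
    fixed point modulo 3.\<close>
  have "\<not> coprime (k - 1) 3" using fixed_point_exists[of k 3 s] nofix[of 3] nL by auto
  then have "3 dvd k - 1"
    using prime_imp_coprime[of 3 "k - 1"] by (auto simp: coprime_commute)
  then have k1: "[k = 1] (mod 3)" using k by (simp add: cong_altdef_nat)
  have L: "L \<noteq> 0" using nL n by auto
  define j where "j = multiplicity 3 L"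
  have "3 ^ j dvd L" by (simp add: j_def multiplicity_dvd)
  then have "3 ^ Suc j dvd n" unfolding nL by simp
  then have "3 ^ Suc j dvd L" using geo_3_dvd[OF k1] ndvd dvd_trans by blast
  then show False using L power_dvd_iff_le_multiplicity[of L 3 "Suc j"] by (simp add: j_def)
qed

text \<open>First displacements have gcd \<open>r\<close> or 1 with \<open>n = r * N\<close>. For
  odd \<open>r\<close> this gives two cycle lengths: \<open>L\<close> on the class \<open>A\<close>
  of the fixed point modulo \<open>r\<close>, and \<open>M\<close> on the complement
  \<open>B\<close>. Comparing them leaves one cycle in \<open>A\<close> and two in \<open>B\<close>;
  as \<open>r - 1\<close> divides \<open>M\<close>, the equation \<open>2 * M = N * (r - 1)\<close>
  makes \<open>N\<close> even.\<close>

lemma three_orbits_one_prime: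
  assumes n: "n > 0" and cop: "coprime k n" and k: "k > 0" and norb: "norb k s n = 3"
    and r: "prime r" "r dvd n" "r dvd s + (k - 1) * t"
    and nosq: "\<And>t. \<not> (r\<^sup>2 dvd n \<and> r\<^sup>2 dvd s + (k - 1) * t)"
    and nofix: "\<And>l t. prime l \<Longrightarrow> l dvd n \<Longrightarrow> l \<noteq> r \<Longrightarrow> \<not> l dvd s + (k - 1) * t"
    and ord: "ord r k = r - 1"
  shows "odd r" "2 dvd n"
proof -
  have r1: "r > 1" using r(1) prime_gt_1_nat by blast
  \<comment> \<open>A prime dividing both the displacement and \<open>n\<close> gives a fixed point
    modulo that prime, so it is \<open>r\<close>; \<open>nosq\<close> excludes the square of
    \<open>r\<close>.\<close>
  have dD: "gcd ((k - 1) * x + s) n = (if r dvd (k - 1) * x + s then r else 1)" for x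
  proof -
    let ?g = "gcd ((k - 1) * x + s) n"
    have pr: "l = r" if "prime l" "l dvd ?g" for l
      using nofix[of l x] that by (auto simp: add.commute)
    show ?thesis
    proof (cases "r dvd (k - 1) * x + s")
      case True
      then have "r dvd ?g" using r(2) by simp
      then obtain h where h: "?g = r * h" by blast
      have "h = 1"
      proof (rule ccontr)
        assume "h \<noteq> 1"
        then obtain l where l: "prime l" "l dvd h" using prime_factor_nat by blast
        then have "l dvd ?g" unfolding h by simp
        then have "r dvd h" using pr l by blast
        then have "r\<^sup>2 dvd ?g" unfolding h power2_eq_square by simp
        then show False using nosq[of x] by (simp add: add.commute)
      qed
      then show ?thesis using h True by simp
    next
      case False
      have "?g = 1"
      proof (rule ccontr)
        assume "?g \<noteq> 1"
        then obtain l where l: "prime l" "l dvd ?g" using prime_factor_nat by blast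
        then have "r dvd ?g" using pr by blast
        then show False using False by simp
      qed
      then show ?thesis using False by simp
    qed
  qed
  have cr: "coprime k r" using cop r(2) by (meson coprime_divisors dvd_refl)
  obtain N where N: "n = r * N" using r(2) by blast
  have N0: "N > 0" using n N by simp
  have cardsize: "card (aorb k s n x) = card (aorb k s n y)"
    if "r dvd (k - 1) * x + s \<longleftrightarrow> r dvd (k - 1) * y + s" for x y
    by (rule card_aorb_gcd[OF n cop k]) (simp only: dD that)
  show odd: "odd r"
  proof
    assume "even r"
    \<comment> \<open>For \<open>r = 2\<close> all displacements are even, so all cycles have the
      same length. The even residues are an invariant half of all residues and would contain exactly
      half of the three cycles.\<close>
    then have r2: "r = 2" using primes_dvd_imp_eq[OF two_is_prime_nat r(1)] by simp
    have "odd k" using cr r2 by simp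
    moreover have "even s" using r(3) r2 calculation by simp
    ultimately have all: "r dvd (k - 1) * x + s" for x using r2 by simp
    define L where "L = card (aorb k s n 0)"
    have cardL: "card (aorb k s n x) = L" for x unfolding L_def by (rule cardsize) (simp only: all)
    then have "card {..<n} = L * norb k s n" unfolding norb_def
      by (intro card_invariant[OF n cop] aorb_subset[OF n] order_refl)
    then have nL: "n = L * 3" by (simp add: norb)
    have inv: "even x = even y" if "[aff k s 1 x = y] (mod n)" for x y
    proof -
      have "[k * x + s = y] (mod 2)"
        using cong_dvd_modulus_nat[OF that, of 2] r(2) r2 by (simp add: aff_def)
      then have "even (k * x + s) = even y" by (rule cong_dvd_iff)
      then show ?thesis using \<open>odd k\<close> \<open>even s\<close> by simp
    qed
    let ?E = "{x. x < n \<and> even x}"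
    have "card ?E = L * card (aorb k s n ` ?E)"
      by (rule card_invariant[OF n cop])
        (use norb_split(2)[OF n cop, of s even, OF inv] cardL in auto)
    moreover have "?E = {x. x < 2 * N \<and> [x = 0] (mod 2)}" using N r2 by (auto simp: cong_0_iff)
    then have "card ?E = N" using card_residue_class[of 2 N 0] by simp
    ultimately have "L * (2 * card (aorb k s n ` ?E)) = L * 3" using N nL r2 by simp
    moreover have "L > 0" using nL n by auto
    ultimately have "2 * card (aorb k s n ` ?E) = 3" by simp
    then show False by presburger
  qed
  have r2: "r > 2" using r1 odd by (cases "r = 2") auto
  have rk: "\<not> r dvd k - 1"
  proof
    assume "r dvd k - 1"
    then have "[k = 1] (mod r)" using k by (simp add: cong_altdef_nat)
    then have "ord r k = 1" by (simp add: ord_eq_Suc_0_iff)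
    then show False using ord r2 by simp
  qed
  then have ck: "coprime (k - 1) r" using r(1) prime_imp_coprime coprime_commute by blast
  have rN: "coprime N r"
  proof -
    \<comment> \<open>\<open>k - 1\<close> is a unit modulo \<open>r\<close>, so a fixed point
      modulo the square of \<open>r\<close> exists; \<open>nosq\<close> then keeps that square from
      dividing \<open>n\<close>.\<close>
    have "\<not> r\<^sup>2 dvd n" using nosq fixed_point_exists[of k "r\<^sup>2" s] ck r1 by auto
    then have "\<not> r dvd N" by (auto simp: N power2_eq_square)
    then show ?thesis using r(1) prime_imp_coprime coprime_commute by blast
  qed
  define A where "A = {x. x < n \<and> r dvd (k - 1) * x + s}"
  define B where "B = {x. x < n \<and> \<not> r dvd (k - 1) * x + s}"
  have inv: "(r dvd (k - 1) * x + s) = (r dvd (k - 1) * y + s)" if "[aff k s 1 x = y] (mod n)" for x y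
  proof -
    have "[(k - 1) * (k * x + s) + s = (k - 1) * y + s] (mod r)"
      using cong_dvd_modulus_nat[OF that r(2)] by (intro cong_add cong_mult cong_refl) (simp add: aff_def)
    moreover have "(k - 1) * (k * x + s) + s = k * ((k - 1) * x + s)"
      using k by (cases k) (simp_all add: algebra_simps)
    ultimately have "r dvd k * ((k - 1) * x + s) \<longleftrightarrow> r dvd (k - 1) * y + s" by (metis cong_dvd_iff)
    then show ?thesis using cr by (simp add: coprime_commute coprime_dvd_mult_right_iff)
  qed
  note split = norb_split[OF n cop, of s "\<lambda>x. r dvd (k - 1) * x + s", OF inv]
  have Ai: "x \<in> A \<longleftrightarrow> x < n \<and> [x = t] (mod r)" for x
  proof -
    have "r dvd (k - 1) * x + s \<longleftrightarrow> [(k - 1) * x + s = (k - 1) * t + s] (mod r)"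
      using r(3) by (metis add.commute cong_0_iff cong_dvd_iff cong_sym cong_trans)
    also have "\<dots> \<longleftrightarrow> [x = t] (mod r)"
      using ck by (simp add: cong_add_rcancel_nat cong_mult_lcancel_nat)
    finally show ?thesis by (simp add: A_def)
  qed
  have "A = {x. x < r * N \<and> [x = t] (mod r)}" unfolding N[symmetric] using Ai by blast
  then have cardA: "card A = N" using card_residue_class[of r N t] r1 by simp
  have "{..<n} = A \<union> B" "A \<inter> B = {}" by (auto simp: A_def B_def)
  then have "n = card A + card B" by (metis card_Un_disjoint card_lessThan finite_Un finite_lessThan)
  then have cardB: "card B = N * (r - 1)" using cardA N by (simp add: algebra_simps)
  have "A \<noteq> {}" "B \<noteq> {}" using cardA cardB N0 r1 by auto
  then obtain a b where a: "a \<in> A" and b: "b \<in> B" by blast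
  define L where "L = card (aorb k s n a)"
  define M where "M = card (aorb k s n b)"
  define cA where "cA = card (aorb k s n ` A)"
  define cB where "cB = card (aorb k s n ` B)"
  have A: "N = L * cA" unfolding cardA[symmetric] cA_def
  proof (rule card_invariant[OF n cop])
    fix x assume x: "x \<in> A"
    show "aorb k s n x \<subseteq> A" using split(2)[of x] x by (auto simp: A_def)
    show "card (aorb k s n x) = L" unfolding L_def using x a by (intro cardsize) (simp add: A_def)
  qed (auto simp: A_def)
  have B: "N * (r - 1) = M * cB" unfolding cardB[symmetric] cB_def
  proof (rule card_invariant[OF n cop])
    fix x assume x: "x \<in> B"
    show "aorb k s n x \<subseteq> B" using split(2)[of x] x by (auto simp: B_def)
    show "card (aorb k s n x) = M" unfolding M_def using x b by (intro cardsize) (simp add: B_def)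
  qed (auto simp: B_def)
  have sum: "cA + cB = 3" using split(1) norb by (simp add: cA_def cB_def A_def B_def)
  have "cA > 0" using A N0 by (auto intro: Nat.gr0I)
  have "cB > 0" using B N0 r1 by (auto intro: Nat.gr0I)
  have L0: "L > 0" using A N0 by (auto intro: Nat.gr0I)
  have M0: "M > 0" using B N0 r1 by (auto intro: Nat.gr0I)
  have per: "n dvd geo k (card (aorb k s n x)) * ((k - 1) * x + s)" for x
    unfolding aff_fixed_iff[OF k, symmetric] card_aorb[OF n cop] by (rule per(2)[OF n cop])
  \<comment> \<open>The displacement of \<open>b\<close> is prime to \<open>r\<close>, so its return
    after \<open>M\<close> steps makes \<open>r\<close> divide \<open>geo k M\<close>, and
    \<open>k ^ M\<close> is 1 modulo \<open>r\<close>.\<close>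
  have "r - 1 dvd M"
  proof -
    have "\<not> r dvd (k - 1) * b + s" using b by (simp add: B_def)
    moreover have "r dvd geo k M * ((k - 1) * b + s)" using per[of b] r(2) by (auto simp: M_def)
    ultimately have "r dvd geo k M" using r(1) prime_dvd_multD by blast
    then have "[(k - 1) * geo k M + 1 = 0 + 1] (mod r)" by (intro cong_add cong_refl) (simp add: cong_0_iff)
    then show ?thesis unfolding geo_eq_power[OF k] ord[symmetric] by (simp add: ord_divides')
  qed
  then obtain j where j: "M = (r - 1) * j" by blast
  \<comment> \<open>The return of \<open>a\<close> after \<open>L\<close> steps gives
    \<open>N dvd geo k L\<close>. Taking \<open>r - 1\<close> times as many steps adds the factor
    \<open>r\<close>, since \<open>k\<close> has order \<open>r - 1\<close> and \<open>k - 1\<close>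
    is a unit modulo \<open>r\<close>; then every point returns.\<close>
  have "M \<le> L * (r - 1)"
  proof -
    have "gcd ((k - 1) * a + s) n = r" using a dD by (simp add: A_def)
    then have "n dvd geo k L * r" using per[of a]
      by (metis L_def dvd_triv_right gcd_greatest_iff gcd_mult_distrib_nat)
    then have "N dvd geo k L" using r1 by (simp add: N mult.commute)
    then have "N dvd geo k (L * (r - 1))" unfolding geo_mult by simp
    moreover have "r dvd geo k (L * (r - 1))"
    proof -
      have "[(k - 1) * geo k (L * (r - 1)) + 1 = 0 + 1] (mod r)"
        unfolding geo_eq_power[OF k] by (simp add: ord_divides' ord)
      then have "r dvd (k - 1) * geo k (L * (r - 1))" by (simp only: cong_add_rcancel_nat cong_0_iff)
      then show ?thesis using rk r(1) prime_dvd_multD by blast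
    qed
    ultimately have "n dvd geo k (L * (r - 1))" using rN by (simp add: N divides_mult coprime_commute)
    then show ?thesis unfolding M_def card_aorb[OF n cop]
      using L0 r1 by (intro per_le) (auto simp: aff_fixed_iff[OF k])
  qed
  moreover have "cA \<noteq> 2"
  proof
    assume "cA = 2"
    then have "M = 2 * (L * (r - 1))" using A B sum by simp
    then show False using \<open>M \<le> L * (r - 1)\<close> M0 by simp
  qed
  ultimately have "cA = 1" "cB = 2" using sum \<open>cA > 0\<close> \<open>cB > 0\<close> by auto
  then have "(r - 1) * N = (r - 1) * (2 * j)" using B j by (simp add: mult.commute)
  then have "N = 2 * j" using r1 by simp
  then show "2 dvd n" by (simp add: N)
qed

text \<open>Modulo a prime \<open>r\<close> with a fixed point \<open>t\<close>, the map becomes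
  multiplication by \<open>k\<close>, with \<open>c + 1\<close> cycles where
  \<open>c * ord r k = r - 1\<close>; so \<open>c\<close> is 1 or 2. The value 2 is the first case.
  For \<open>c = 1\<close>, a fixed point modulo the square of \<open>r\<close> gives the second
  case; otherwise \<open>r\<close> is the only prime with a fixed point, and
  \<open>three_orbits_one_prime\<close> leads to the third.\<close>

lemma three_orbits:
  assumes n: "n > 0" and cop: "coprime k n" and k: "k > 0" and norb: "norb k s n = 3"
  obtains
    (prime) r t where "prime r" "r dvd n" "r \<noteq> 2" "r dvd s + (k - 1) * t" "ord r k = (r - 1) div 2"
  | (square) r t where "prime r" "r\<^sup>2 dvd n" "r\<^sup>2 dvd s + (k - 1) * t" "ord (r\<^sup>2) k = r\<^sup>2 - r"
  | (double) r t where "prime r" "2 * r dvd n" "r \<noteq> 2" "odd k" "odd s"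
      "r dvd s + (k - 1) * t" "ord r k = r - 1"
proof -
  obtain r t where r: "prime r" "r dvd n" "r dvd s + (k - 1) * t"
    using three_orbits_no_fixed_point[OF assms] by blast
  have cr: "coprime k r" using cop r(2) by (meson coprime_divisors dvd_refl)
  have r1: "r > 1" using r(1) prime_gt_1_nat by blast
  have red: "norb k 0 m \<le> 3" if "m dvd n" "m dvd s + (k - 1) * u" for m u
  proof -
    have m: "m > 0" using that(1) n by (auto intro: Nat.gr0I)
    have "norb k 0 m = norb k (s + (k - 1) * u) m"
      using that(2) by (intro norb_cong) (metis cong_0_iff cong_sym)
    also have "\<dots> \<le> norb k s n"
      unfolding norb_translate[OF m k] by (rule norb_mono[OF that(1) n])
    finally show ?thesis by (simp add: norb)
  qed
  obtain c where c: "c * ord r k = r - 1" "norb k 0 r = c + 1"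
    using norb_prime[OF r(1) cr] by blast
  have "c \<le> 2" using c(2) red[OF r(2,3)] by simp
  moreover have "c \<noteq> 0" using c(1) r1 by (intro notI) simp
  ultimately consider "c = 2" | "c = 1" by linarith
  then show thesis
  proof cases
    case 1
    then have "r \<noteq> 2" using c(1) by auto
    then show ?thesis using prime[OF r(1,2) _ r(3)] c(1) 1 by auto
  next
    case 2
    then have ord: "ord r k = r - 1" using c(1) by simp
    show ?thesis
    proof (cases "\<exists>t. r\<^sup>2 dvd n \<and> r\<^sup>2 dvd s + (k - 1) * t")
      case True
      then obtain u where u: "r\<^sup>2 dvd n" "r\<^sup>2 dvd s + (k - 1) * u" by blast
      then show ?thesis using square[OF r(1) u] norb_prime_square[OF r(1) cr red[OF u]] by blast
    next
      case False
      \<comment> \<open>Fixed points modulo \<open>r\<close> and \<open>l\<close> combine by the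
        Chinese remainder theorem; the four divisors of \<open>r * l\<close> would then give four
        cycles.\<close>
      have nofix: "\<not> l dvd s + (k - 1) * u" if l: "prime l" "l dvd n" "l \<noteq> r" for l u
      proof
        assume lu: "l dvd s + (k - 1) * u"
        have co: "coprime r l" using l r(1) primes_coprime by blast
        obtain v where v: "[v = t] (mod r)" "[v = u] (mod l)"
          using binary_chinese_remainder_nat[OF co] by blast
        have "[s + (k - 1) * v = s + (k - 1) * t] (mod r)" "[s + (k - 1) * v = s + (k - 1) * u] (mod l)"
          using v by (auto intro!: cong_add cong_mult)
        then have "r dvd s + (k - 1) * v" "l dvd s + (k - 1) * v"
          using r(3) lu cong_dvd_iff by blast+
        then have *: "r * l dvd s + (k - 1) * v" "r * l dvd n"
          using co r(2) l(2) divides_mult by blast+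
        have m: "r * l > 0" using *(2) n by (auto intro: Nat.gr0I)
        have "coprime k (r * l)" using cop *(2) by (meson coprime_divisors dvd_refl)
        then have "card {d. d dvd r * l} \<le> norb k 0 (r * l)"
          using card_divisors_le_norb[OF m k, of 0 0] by simp
        also have "\<dots> \<le> 3" using red * by blast
        finally have "card {d. d dvd r * l} \<le> 3" .
        moreover have "card {1, r, l, r * l} = 4"
          using r(1) l by (auto simp: card_insert_if dest: prime_gt_1_nat)
        moreover have "card {1, r, l, r * l} \<le> card {d. d dvd r * l}"
          using m by (intro card_mono finite_divisors_nat) auto
        ultimately show False by linarith
      qed
      have odd: "odd r" "2 dvd n"
        using three_orbits_one_prime[OF assms r] False nofix ord by blast+
      have "odd k" using cop odd(2) by (metis coprime_common_divisor odd_one)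
      have "2 \<noteq> r" using odd by auto
      \<comment> \<open>For odd \<open>k\<close> the map modulo 2 is addition of \<open>s\<close>,
        which has no fixed point only if \<open>s\<close> is odd.\<close>
      then have "\<not> even (s + (k - 1) * 0)" using nofix[OF two_is_prime_nat] odd by blast
      then have "odd s" by simp
      moreover have "2 * r dvd n" using odd r(2) by (intro divides_mult) (auto simp: coprime_left_2_iff_odd)
      ultimately show ?thesis using double[OF r(1) _ _ \<open>odd k\<close> _ r(3) ord] \<open>2 \<noteq> r\<close> by metis
    qed
  qed
qed

section \<open>Permutation groups and rank\<close>

lemma carrier_Perm: "carrier Perm = {f. bij f}"
  by (simp add: BijGroup_def Bij_def extensional_UNIV)

lemma mult_Perm: "bij f \<Longrightarrow> bij g \<Longrightarrow> f \<otimes>\<^bsub>Perm\<^esub> g = f \<circ> g"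
  by (simp add: BijGroup_def Bij_def extensional_UNIV compose_def fun_eq_iff)

lemma one_Perm: "\<one>\<^bsub>Perm\<^esub> = id"
  by (simp add: BijGroup_def fun_eq_iff)

lemma inv_Perm:
  assumes "bij f"
  shows "inv\<^bsub>Perm\<^esub> f = inv_into UNIV f"
proof (rule group.inv_equality[OF group_BijGroup])
  show "inv_into UNIV f \<otimes>\<^bsub>Perm\<^esub> f = \<one>\<^bsub>Perm\<^esub>"
    using assms by (simp add: mult_Perm one_Perm bij_imp_bij_inv bij_is_inj)
qed (use assms in \<open>simp_all add: carrier_Perm bij_imp_bij_inv\<close>)

lemma subgroup_PermD:
  assumes "subgroup H Perm"
  shows "f \<in> H \<Longrightarrow> bij f" "f \<in> H \<Longrightarrow> g \<in> H \<Longrightarrow> f \<circ> g \<in> H" "id \<in> H" "f \<in> H \<Longrightarrow> inv_into UNIV f \<in> H"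
proof -
  show b: "bij f" if "f \<in> H" for f
    using subgroup.subset[OF assms] that by (auto simp: carrier_Perm)
  show "f \<circ> g \<in> H" if "f \<in> H" "g \<in> H"
    using subgroup.m_closed[OF assms that] b that by (simp add: mult_Perm)
  show "id \<in> H" using subgroup.one_closed[OF assms] by (simp add: one_Perm)
  show "inv_into UNIV f \<in> H" if "f \<in> H"
    using subgroup.m_inv_closed[OF assms that] b that by (simp add: inv_Perm)
qed

text \<open>Left composition with \<open>f\<close> is injective on the finite set \<open>H\<close>,
  hence onto; this yields the identity and inverses.\<close>

lemma subgroup_PermI:
  fixes H :: "('a::finite \<Rightarrow> 'a) set"
  assumes "H \<noteq> {}" and bij: "\<And>f. f \<in> H \<Longrightarrow> bij f"
    and comp: "\<And>f g. f \<in> H \<Longrightarrow> g \<in> H \<Longrightarrow> f \<circ> g \<in> H"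
  shows "subgroup H Perm"
proof (rule group.subgroupI[OF group_BijGroup])
  show "H \<subseteq> carrier Perm" using bij by (auto simp: carrier_Perm)
  show "H \<noteq> {}" by fact
  show "f \<otimes>\<^bsub>Perm\<^esub> g \<in> H" if "f \<in> H" "g \<in> H" for f g
    using that bij comp by (simp add: mult_Perm)
  fix f assume f: "f \<in> H"
  have "inj_on (\<lambda>g. f \<circ> g) H" using bij_is_inj[OF bij[OF f]] by (auto simp: inj_on_def fun_eq_iff)
  then have surj: "(\<lambda>g. f \<circ> g) ` H = H" using comp[OF f] by (intro endo_inj_surj) auto
  then obtain e where e: "e \<in> H" "f \<circ> e = f" using f by (metis imageE)
  have "f (e x) = f x" for x using fun_cong[OF e(2), of x] by simp
  then have "e = id" using bij_is_inj[OF bij[OF f]] by (auto simp: fun_eq_iff inj_eq)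
  then obtain g where g: "g \<in> H" "f \<circ> g = id" using e(1) surj by (metis imageE)
  have "f (g x) = x" for x using fun_cong[OF g(2), of x] by simp
  then have "inv_into UNIV f = g" using inv_f_eq[OF bij_is_inj[OF bij[OF f]]] by blast
  then show "inv\<^bsub>Perm\<^esub> f \<in> H" using g bij[OF f] by (simp add: inv_Perm)
qed

lemma subgroup_generate_Perm:
  assumes "\<And>f. f \<in> S \<Longrightarrow> bij f"
  shows "subgroup (generate Perm S) Perm"
  using assms by (intro group.generate_is_subgroup[OF group_BijGroup]) (auto simp: carrier_Perm)

lemma conjugate_in_Perm:
  assumes "\<And>g. g \<in> L \<Longrightarrow> bij g" "\<And>h. h \<in> H \<Longrightarrow> bij h"
  shows "conjugate_in L H K \<longleftrightarrow> (\<exists>g\<in>L. K = (\<lambda>h. g \<circ> h \<circ> inv_into UNIV g) ` H)"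
proof -
  have "g <#\<^bsub>Perm\<^esub> H #>\<^bsub>Perm\<^esub> (inv\<^bsub>Perm\<^esub> g) = (\<lambda>h. g \<circ> h \<circ> inv_into UNIV g) ` H" if "g \<in> L" for g
    using assms that
    by (auto simp: l_coset_def r_coset_def mult_Perm inv_Perm bij_comp bij_imp_bij_inv image_iff)
  then show ?thesis unfolding conjugate_in_def by auto
qed

text \<open>Orbits are taken on all points. For a stabilizer of 0 the orbit of 0 counts too, so a
  count of 4 means three orbits on nonzero elements.\<close>

definition orbit_count :: "('a \<Rightarrow> 'a) set \<Rightarrow> nat"
  where "orbit_count H = card (range (\<lambda>z. (\<lambda>g. g z) ` H))"

text \<open>Closing an \<open>H\<close>-orbit under \<open>K\<close> gives a \<open>K\<close>-orbit,
  and every \<open>K\<close>-orbit arises in this way.\<close>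

lemma orbit_count_antimono:
  fixes H :: "('a::finite \<Rightarrow> 'a) set"
  assumes "subgroup H Perm" "subgroup K Perm" "H \<subseteq> K"
  shows "orbit_count K \<le> orbit_count H"
proof -
  define \<Phi> where "\<Phi> X = (\<Union>y\<in>X. (\<lambda>g. g y) ` K)" for X
  have "(\<lambda>g. g z) ` K = \<Phi> ((\<lambda>g. g z) ` H)" for z
    unfolding \<Phi>_def
  proof (intro equalityI subsetI)
    fix v assume "v \<in> (\<lambda>g. g z) ` K"
    moreover have "z \<in> (\<lambda>g. g z) ` H"
      using subgroup_PermD(3)[OF assms(1)] by (intro image_eqI[of _ _ id]) simp_all
    ultimately show "v \<in> (\<Union>y\<in>(\<lambda>g. g z) ` H. (\<lambda>g. g y) ` K)" by blast
  next
    fix v assume "v \<in> (\<Union>y\<in>(\<lambda>g. g z) ` H. (\<lambda>g. g y) ` K)"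
    then obtain h g where "h \<in> H" "g \<in> K" "v = (g \<circ> h) z" by auto
    moreover have "g \<circ> h \<in> K" using calculation assms(3) subgroup_PermD(2)[OF assms(2)] by blast
    ultimately show "v \<in> (\<lambda>g. g z) ` K" by blast
  qed
  then have "range (\<lambda>z. (\<lambda>g. g z) ` K) = \<Phi> ` range (\<lambda>z. (\<lambda>g. g z) ` H)"
    by (simp add: image_image)
  then show ?thesis unfolding orbit_count_def by (simp add: card_image_le)
qed

lemma point_stabilizer_eq: "point_stabilizer G x = {g \<in> G. g x = x}"
  by (simp add: point_stabilizer_def stabilizer_def)

lemma subgroup_point_stabilizer:
  fixes G :: "('a::finite \<Rightarrow> 'a) set"
  assumes "subgroup G Perm"
  shows "subgroup (point_stabilizer G x) Perm"
  using subgroup_PermD[OF assms] by (intro subgroup_PermI) (auto simp: point_stabilizer_eq)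

text \<open>
  The orbit of \<open>(x, y)\<close> is determined by its slice above \<open>0\<close>, which is the orbit of \<open>y - x\<close>
  under the stabilizer of \<open>0\<close>.
\<close>

lemma rank_eq_orbit_count:
  fixes G :: "('a::{field,finite} \<Rightarrow> 'a) set"
  assumes G: "subgroup G Perm" and "add_group \<subseteq> G"
  shows "has_rank G k \<longleftrightarrow> orbit_count (point_stabilizer G 0) = k"
proof -
  note [simp] = subgroup_PermD(1)[OF G]
  let ?P = "Perm\<lparr>carrier := G\<rparr>" and ?G0 = "point_stabilizer G 0"
  have tr: "translation c \<in> G" for c using assms(2) by (auto simp: add_group_def)
  let ?slice = "\<lambda>X. {z. (0, z) \<in> X}"
  have orb: "orbit ?P (\<lambda>g. map_prod g g) (x, y) = {(g x, g y) | g. g \<in> G}" for x y :: 'a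
    by (auto simp: orbit_def)
  have shift: "{(g x, g y) | g. g \<in> G} = {(g 0, g (y - x)) | g. g \<in> G}" for x y :: 'a
  proof (intro equalityI subsetI)
    fix v assume "v \<in> {(g x, g y) | g. g \<in> G}"
    then obtain g where g: "g \<in> G" "v = (g x, g y)" by blast
    have "g \<circ> translation x \<in> G" using subgroup_PermD(2)[OF G g(1) tr] .
    moreover have "v = ((g \<circ> translation x) 0, (g \<circ> translation x) (y - x))"
      using g by (simp add: translation_def)
    ultimately show "v \<in> {(g 0, g (y - x)) | g. g \<in> G}" by blast
  next
    fix v assume "v \<in> {(g 0, g (y - x)) | g. g \<in> G}"
    then obtain g where g: "g \<in> G" "v = (g 0, g (y - x))" by blast
    have "g \<circ> translation (- x) \<in> G" using subgroup_PermD(2)[OF G g(1) tr] .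
    moreover have "v = ((g \<circ> translation (- x)) x, (g \<circ> translation (- x)) y)"
      using g by (simp add: translation_def)
    ultimately show "v \<in> {(g x, g y) | g. g \<in> G}" by blast
  qed
  let ?O = "\<lambda>z. {(g 0, g z) | g. g \<in> G}"
  have "orbits ?P (UNIV \<times> UNIV) (\<lambda>g. map_prod g g) = range ?O"
  proof (intro equalityI subsetI)
    fix X assume "X \<in> orbits ?P (UNIV \<times> UNIV) (\<lambda>g. map_prod g g)"
    then obtain x y where "X = orbit ?P (\<lambda>g. map_prod g g) (x, y)" by (auto simp: orbits_def)
    then have "X = ?O (y - x)" unfolding orb by (simp only: shift[of x y])
    then show "X \<in> range ?O" by blast
  next
    fix X assume "X \<in> range ?O"
    then obtain z where "X = orbit ?P (\<lambda>g. map_prod g g) (0, z)" unfolding orb by blast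
    then show "X \<in> orbits ?P (UNIV \<times> UNIV) (\<lambda>g. map_prod g g)" unfolding orbits_def by blast
  qed
  moreover have sl: "?slice (?O z) = (\<lambda>g. g z) ` ?G0" for z
    unfolding point_stabilizer_eq by fastforce
  moreover have "inj_on ?slice (range ?O)"
  proof (rule inj_onI)
    fix X Y assume "X \<in> range ?O" "Y \<in> range ?O" and eq: "?slice X = ?slice Y"
    then obtain y z where yz: "X = ?O y" "Y = ?O z" by blast
    \<comment> \<open>Equal slices give \<open>y = h z\<close> with \<open>h\<close> fixing 0;
      composing with \<open>h\<close> or its inverse identifies the two orbits.\<close>
    have "y \<in> (\<lambda>g. g y) ` ?G0"
      using subgroup_PermD(3)[OF G] by (force simp: point_stabilizer_eq image_iff)
    then have "y \<in> (\<lambda>g. g z) ` ?G0" using eq unfolding yz sl by simp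
    then obtain h where h: "h \<in> G" "h 0 = 0" "y = h z" by (auto simp: point_stabilizer_eq)
    have "?O y = ?O z"
    proof (intro equalityI subsetI)
      fix v assume "v \<in> ?O y"
      then obtain g where g: "g \<in> G" "v = (g 0, g y)" by blast
      then have "v = ((g \<circ> h) 0, (g \<circ> h) z)" "g \<circ> h \<in> G"
        using h subgroup_PermD(2)[OF G] by simp_all
      then show "v \<in> ?O z" by blast
    next
      fix v assume "v \<in> ?O z"
      then obtain g where g: "g \<in> G" "v = (g 0, g z)" by blast
      have "inv_into UNIV h 0 = 0" "inv_into UNIV h y = z" using h by (simp_all add: inv_f_eq bij_is_inj)
      then have "v = ((g \<circ> inv_into UNIV h) 0, (g \<circ> inv_into UNIV h) y)" "g \<circ> inv_into UNIV h \<in> G"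
        using h g subgroup_PermD(2,4)[OF G] by simp_all
      then show "v \<in> ?O y" by blast
    qed
    then show "X = Y" by (simp only: yz)
  qed
  then have "card (range ?O) = card (?slice ` range ?O)" by (simp only: card_image)
  ultimately have card: "card (orbits ?P (UNIV \<times> UNIV) (\<lambda>g. map_prod g g)) = orbit_count ?G0"
    unfolding orbit_count_def by (simp only: image_image sl)
  have "transitive_action ?P UNIV (\<lambda>g. g)"
  proof -
    have "group_hom ?P Perm (\<lambda>g. g)"
      using group.subgroup_imp_group[OF group_BijGroup G] group_BijGroup subgroup.subset[OF G]
      by (auto simp: group_hom_def group_hom_axioms_def hom_def)
    then have "group_action ?P UNIV (\<lambda>g. g)" by (simp add: group_action_def)
    moreover have "\<exists>g\<in>G. g x = y" for x y :: 'a
      using tr[of "y - x"] by (intro bexI[of _ "translation (y - x)"]) (simp_all add: translation_def)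
    ultimately show ?thesis by (simp add: transitive_action_def transitive_action_axioms_def)
  qed
  then show ?thesis by (simp only: has_rank_def card simp_thms)
qed

section \<open>Semilinear and affine groups of dimension one\<close>

text \<open>A substitute for negation of natural exponents: \<open>(n - 1) * x\<close> is
  \<open>- x\<close> modulo every divisor of \<open>n\<close>. With \<open>n = q - 1\<close> this
  explains the terms \<open>(q - 1 - 1) * x\<close> below.\<close>

lemma cong_neg_nat:
  fixes x y m n :: nat
  assumes "m > 0" "m dvd n" "n > 0"
  shows "[x + (y + (n - 1) * x) = y] (mod m)"
proof -
  have "x + (y + (n - 1) * x) = y + n * x" using assms(3) by (cases n) simp_all
  moreover have "[y + n * x = y + 0] (mod m)"
    using assms(2) by (intro cong_add cong_refl) (simp add: cong_0_iff)
  ultimately show ?thesis by (simp only: add_0_right)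
qed

locale primitive_root =
  fixes w :: "'a::{field,finite}" and p q :: nat
  assumes prime_p: "prime p" and card_power: "\<exists>d. q = p ^ d" and card: "CARD('a) = q"
    and primitive: "primitive_element w"
begin

section \<open>Powers of the primitive element\<close>

lemma w_nonzero: "w \<noteq> 0"
proof -
  have "w ^ 1 \<in> UNIV - {0}" using primitive unfolding primitive_element_def by blast
  then show ?thesis by simp
qed

lemma nonzero_power:
  assumes "x \<noteq> 0"
  obtains k where "x = w ^ k"
proof -
  have "x \<in> range (\<lambda>k. w ^ k)" using primitive assms unfolding primitive_element_def by blast
  then show thesis using that by blast
qed

lemma q_gt_1: "q > 1"
proof -
  have "card {0, 1 :: 'a} \<le> CARD('a)" by (rule card_mono) auto
  then show ?thesis by (simp add: card)
qed

lemma p_dvd_q: "p dvd q"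
proof -
  obtain d where d: "q = p ^ d" using card_power by blast
  then have "d \<noteq> 0" using q_gt_1 by (auto intro: Nat.gr0I)
  then show ?thesis using d by simp
qed

lemma coprime_p: "coprime p (q - 1)"
proof -
  have "coprime q (q - 1)" using coprime_diff_one_left_nat[of q] q_gt_1 by (simp add: coprime_commute)
  then show ?thesis using p_dvd_q by (meson coprime_divisors dvd_refl)
qed

lemma p_pos [simp]: "p > 0"
  using prime_p by (rule prime_gt_0_nat)

text \<open>With \<open>m\<close> the least positive exponent that gives 1, the powers below
  \<open>m\<close> are distinct and run through all nonzero elements, so
  \<open>m = q - 1\<close>.\<close>

lemma power_eq_iff: "w ^ x = w ^ y \<longleftrightarrow> [x = y] (mod (q - 1))"
proof -
  let ?P = "\<lambda>m. m > 0 \<and> w ^ m = 1"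
  have "\<exists>m. ?P m"
  proof -
    have "\<not> inj (\<lambda>k::nat. w ^ k)"
    proof
      assume inj: "inj (\<lambda>k::nat. w ^ k)"
      have "finite (range (\<lambda>k::nat. w ^ k))" by simp
      then show False using inj finite_imageD infinite_UNIV_nat by blast
    qed
    then obtain i j :: nat where ij: "w ^ i = w ^ j" "i < j"
      unfolding inj_on_def by (metis linorder_neqE_nat)
    have "w ^ j = w ^ i * w ^ (j - i)" using ij(2) by (simp flip: power_add)
    then have "w ^ (j - i) = 1" using ij(1) w_nonzero by simp
    then show ?thesis using ij(2) by (intro exI[of _ "j - i"]) simp
  qed
  define m where "m = (LEAST m. ?P m)"
  have m: "m > 0" "w ^ m = 1" using LeastI_ex[OF \<open>\<exists>m. ?P m\<close>] by (auto simp: m_def)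
  have least: "\<not> (0 < i \<and> i < m \<and> w ^ i = 1)" for i
    using not_less_Least[of i ?P] by (auto simp: m_def)
  have red: "w ^ k = w ^ (k mod m)" for k
  proof -
    have "w ^ k = (w ^ m) ^ (k div m) * w ^ (k mod m)"
      by (simp only: power_mult[symmetric] power_add[symmetric] mult_div_mod_eq)
    then show ?thesis by (simp add: m)
  qed
  have inj: "inj_on (\<lambda>k. w ^ k) {..<m}"
  proof (rule linorder_inj_onI)
    fix i j assume ij: "i < j" "i \<in> {..<m}" "j \<in> {..<m}"
    show "w ^ i \<noteq> w ^ j"
    proof
      assume "w ^ i = w ^ j"
      moreover have "w ^ j = w ^ i * w ^ (j - i)" using ij(1) by (simp flip: power_add)
      ultimately have "w ^ (j - i) = 1" using w_nonzero by simp
      then show False using least[of "j - i"] ij by simp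
    qed
  qed auto
  have "range (\<lambda>k. w ^ k) = (\<lambda>k. w ^ k) ` {..<m}"
  proof
    show "range (\<lambda>k. w ^ k) \<subseteq> (\<lambda>k. w ^ k) ` {..<m}"
    proof (rule image_subsetI)
      show "w ^ k \<in> (\<lambda>k. w ^ k) ` {..<m}" for k
        using red[of k] m(1) by (intro image_eqI[of _ _ "k mod m"]) simp_all
    qed
  qed (rule image_mono[OF subset_UNIV])
  then have "card (UNIV - {0 :: 'a}) = m"
    using primitive card_image[OF inj] by (simp add: primitive_element_def)
  then have qm: "q - 1 = m" by (simp add: card card_Diff_singleton)
  show ?thesis unfolding qm
  proof
    assume "w ^ x = w ^ y"
    then have "w ^ (x mod m) = w ^ (y mod m)" using red[of x] red[of y] by simp
    then show "[x = y] (mod m)" unfolding cong_def using inj m(1) by (simp add: inj_on_def)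
  next
    assume "[x = y] (mod m)"
    then show "w ^ x = w ^ y" using red[of x] red[of y] by (simp add: cong_def)
  qed
qed

lemma frobenius_add: "(x + y :: 'a) ^ (p ^ i) = x ^ (p ^ i) + y ^ (p ^ i)"
proof -
  have "prime CHAR('a)" by (rule prime_CHAR_semidom[OF finite_imp_CHAR_pos]) simp
  moreover have "CHAR('a) dvd p ^ d" if "q = p ^ d" for d
    using CHAR_dvd_CARD[where ?'a = 'a] that by (simp add: card)
  ultimately have "CHAR('a) = p"
    using card_power prime_p by (metis prime_dvd_power primes_dvd_imp_eq)
  then show ?thesis using freshmans_dream'[of "p ^ i" i x y] prime_p by simp
qed

section \<open>Semilinear maps in terms of exponents\<close>

definition gam :: "nat \<Rightarrow> nat \<Rightarrow> 'a \<Rightarrow> 'a"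
  where "gam i u = (\<lambda>x. x ^ (p ^ i) * w ^ u)"

lemma gam_0 [simp]: "gam i u 0 = 0"
  by (simp add: gam_def)

text \<open>The bridge from the field to residues: on exponents of \<open>w\<close> a semilinear map
  is affine with multiplier \<open>p ^ i\<close>.\<close>

lemma gam_power: "gam i u (w ^ x) = w ^ (p ^ i * x + u)"
  by (simp add: gam_def power_add mult.commute flip: power_mult)

lemma gam_add: "gam i u (x + y) = gam i u x + gam i u y"
  by (simp add: gam_def frobenius_add distrib_right)

lemma gam_comp: "gam i u \<circ> gam j v = gam (i + j) (p ^ i * v + u)"
  by (simp add: gam_def fun_eq_iff power_mult_distrib power_add mult.commute mult.assoc
      mult.left_commute flip: power_mult)

lemma gam_eq_iff: "gam i u = gam j v \<longleftrightarrow> (\<forall>x. [p ^ i * x + u = p ^ j * x + v] (mod (q - 1)))"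
proof
  assume "gam i u = gam j v"
  then have "w ^ (p ^ i * x + u) = w ^ (p ^ j * x + v)" for x using gam_power by metis
  then show "\<forall>x. [p ^ i * x + u = p ^ j * x + v] (mod (q - 1))" by (simp add: power_eq_iff)
next
  assume *: "\<forall>x. [p ^ i * x + u = p ^ j * x + v] (mod (q - 1))"
  show "gam i u = gam j v"
  proof
    fix z show "gam i u z = gam j v z"
    proof (cases "z = 0")
      case False
      then obtain x where z: "z = w ^ x" by (rule nonzero_power)
      have "w ^ (p ^ i * x + u) = w ^ (p ^ j * x + v)" using * power_eq_iff by blast
      then show ?thesis unfolding z gam_power .
    qed simp
  qed
qed

lemma gam_cong: "[u = v] (mod (q - 1)) \<Longrightarrow> gam i u = gam i v"
  unfolding gam_eq_iff by (intro allI cong_add cong_refl)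

lemma bij_gam: "bij (gam i u)"
proof -
  have "inj (gam i u)"
  proof (rule injI)
    fix x y assume eq: "gam i u x = gam i u y"
    have zero: "gam i u z = 0 \<longleftrightarrow> z = 0" for z using w_nonzero by (simp add: gam_def)
    show "x = y"
    proof (cases "x = 0 \<or> y = 0")
      case True
      then show ?thesis using eq zero by (metis gam_0)
    next
      case False
      then obtain k l where kl: "x = w ^ k" "y = w ^ l" by (metis nonzero_power)
      then have "[p ^ i * k + u = p ^ i * l + u] (mod (q - 1))"
        using eq by (simp add: gam_power power_eq_iff)
      then have "[k = l] (mod (q - 1))"
        using coprime_p by (simp add: cong_add_rcancel_nat cong_mult_lcancel_nat)
      then show ?thesis by (simp add: kl power_eq_iff)
    qed
  qed
  then show ?thesis by (simp add: bij_def finite_UNIV_inj_surj)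
qed

lemma scaling_eq_gam: "scaling (w ^ u) = gam 0 u"
  by (simp add: scaling_def gam_def)

lemma frob_eq_gam: "frob p = gam 1 0"
  by (simp add: frob_def gam_def)

lemma frob_square_eq_gam: "frob p [^]\<^bsub>Perm\<^esub> (2::nat) = gam 2 0"
proof -
  have "frob p [^]\<^bsub>Perm\<^esub> (2::nat) = frob p \<otimes>\<^bsub>Perm\<^esub> (frob p :: 'a \<Rightarrow> 'a)"
    by (simp add: numeral_2_eq_2 nat_pow_def one_Perm frob_eq_gam mult_Perm bij_gam)
  then show ?thesis by (simp add: frob_eq_gam mult_Perm bij_gam gam_comp numeral_2_eq_2)
qed

lemma scaling_frob_eq_gam: "scaling (w ^ u) \<otimes>\<^bsub>Perm\<^esub> frob p = gam 1 u"
  by (simp add: scaling_eq_gam frob_eq_gam mult_Perm bij_gam gam_comp)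

lemma id_eq_gam: "id = gam 0 0"
  by (simp add: gam_def fun_eq_iff)

lemma subgroup_gam: "subgroup {gam i u | i u. True} Perm"
proof (rule subgroup_PermI)
  fix f g assume "f \<in> {gam i u | i u. True}" "g \<in> {gam i u | i u. True}"
  then obtain i u j v where "f = gam i u" "g = gam j v" by blast
  then have "f \<circ> g = gam (i + j) (p ^ i * v + u)" by (simp only: gam_comp)
  then show "f \<circ> g \<in> {gam i u | i u. True}" by blast
qed (auto simp: bij_gam)

lemma GammaL1_eq: "GammaL1 p = {gam i u | i u. True}"
proof
  have mult: "mult_group = {gam 0 u | u. True}"
  proof -
    have "mult_group = scaling ` range (\<lambda>k. w ^ k)"
      using primitive by (simp add: mult_group_def primitive_element_def)
    then show ?thesis by (auto simp: scaling_eq_gam image_image)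
  qed
  let ?S = "{frob p} \<union> mult_group :: ('a \<Rightarrow> 'a) set"
  have S: "?S \<subseteq> {gam i u | i u. True}" unfolding mult frob_eq_gam by blast
  then show "GammaL1 p \<subseteq> {gam i u | i u. True}"
    unfolding GammaL1_def by (rule group.generate_subgroup_incl[OF group_BijGroup _ subgroup_gam])
  have sub: "subgroup (generate Perm ?S) Perm"
  proof (rule subgroup_generate_Perm)
    fix f assume "f \<in> ?S"
    then obtain i u where "f = gam i u" using S by blast
    then show "bij f" by (simp only: bij_gam)
  qed
  have 0: "gam 0 u \<in> generate Perm ?S" for u
    unfolding mult by (rule generate.incl) blast
  have 1: "gam 1 0 \<in> generate Perm ?S"
    unfolding frob_eq_gam by (rule generate.incl) blast
  have "gam i 0 \<in> generate Perm ?S" for i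
  proof (induction i)
    case (Suc i)
    then show ?case using subgroup_PermD(2)[OF sub 1 Suc] by (simp add: gam_comp)
  qed (rule 0)
  then have "gam i u \<in> generate Perm ?S" for i u
    using subgroup_PermD(2)[OF sub 0[of u], of "gam i 0"] by (simp add: gam_comp)
  then show "{gam i u | i u. True} \<subseteq> GammaL1 p" unfolding GammaL1_def by blast
qed

lemma gam_in_GammaL1: "gam i u \<in> GammaL1 p"
  unfolding GammaL1_eq by blast

section \<open>Affine groups and their stabilizers of 0\<close>

lemma translation_gam_comp:
  "(translation b \<circ> gam i u) \<circ> (translation c \<circ> gam j v) =
    translation (gam i u c + b) \<circ> (gam i u \<circ> gam j v)"
  by (simp add: fun_eq_iff translation_def gam_add)

lemma bij_translation: "bij (translation c :: 'a \<Rightarrow> 'a)"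
  by (rule bij_betw_byWitness[where f' = "\<lambda>x. x - c"]) (auto simp: translation_def)

text \<open>For a subgroup \<open>K\<close> of \<open>GammaL1 p\<close> this is its internal
  semidirect product with the translations. It is closed under composition because semilinear maps
  are additive and can be moved past translations.\<close>

definition affine :: "('a \<Rightarrow> 'a) set \<Rightarrow> ('a \<Rightarrow> 'a) set"
  where "affine K = (\<Union>b. (\<lambda>g. translation b \<circ> g) ` K)"

lemma affineI: "g \<in> K \<Longrightarrow> f = translation b \<circ> g \<Longrightarrow> f \<in> affine K"
  unfolding affine_def by blast

lemma affineE:
  assumes "f \<in> affine K"
  obtains b g where "f = translation b \<circ> g" "g \<in> K"
  using assms unfolding affine_def by (elim UN_E imageE)

lemma subgroup_affine:
  fixes K :: "('a \<Rightarrow> 'a) set"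
  assumes "subgroup K Perm" "K \<subseteq> GammaL1 p"
  shows "subgroup (affine K) Perm"
proof (rule subgroup_PermI)
  show "affine K \<noteq> {}" using affineI[OF subgroup_PermD(3)[OF assms(1)] refl] by blast
  show "bij f" if "f \<in> affine K" for f
    using that
  proof (rule affineE)
    show "bij f" if "f = translation b \<circ> g" "g \<in> K" for b g
      using that by (simp add: bij_comp[OF subgroup_PermD(1)[OF assms(1)] bij_translation])
  qed
  fix f f' assume "f \<in> affine K" "f' \<in> affine K"
  then obtain b g b' g' where *: "f = translation b \<circ> g" "f' = translation b' \<circ> g'" "g \<in> K" "g' \<in> K"
    by (elim affineE)
  moreover obtain i u j v where "g = gam i u" "g' = gam j v" using *(3,4) assms(2) unfolding GammaL1_eq by blast
  ultimately have "f \<circ> f' = translation (g b' + b) \<circ> (g \<circ> g')" by (simp only: translation_gam_comp)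
  then show "f \<circ> f' \<in> affine K" by (rule affineI[OF subgroup_PermD(2)[OF assms(1) *(3,4)]])
qed

lemma subgroup_GammaL1: "subgroup (GammaL1 p :: ('a \<Rightarrow> 'a) set) Perm"
  unfolding GammaL1_eq by (rule subgroup_gam)

lemma translation_0: "translation 0 = (id :: 'a \<Rightarrow> 'a)"
  by (simp add: translation_def fun_eq_iff)

lemma AGammaL1_eq: "AGammaL1 p = affine (GammaL1 p)"
proof
  let ?S = "GammaL1 p \<union> add_group :: ('a \<Rightarrow> 'a) set"
  have "?S \<subseteq> affine (GammaL1 p)"
  proof
    fix f :: "'a \<Rightarrow> 'a" assume "f \<in> ?S"
    then consider "f \<in> GammaL1 p" | b where "f = translation b" by (auto simp: add_group_def)
    then show "f \<in> affine (GammaL1 p)"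
    proof cases
      case 1
      then show ?thesis by (rule affineI[where b = 0]) (simp add: translation_0)
    next
      case 2
      show ?thesis
        by (rule affineI[OF subgroup_PermD(3)[OF subgroup_GammaL1], where b = b]) (simp add: 2)
    qed
  qed
  then show "AGammaL1 p \<subseteq> affine (GammaL1 p)" unfolding AGammaL1_def
    by (rule group.generate_subgroup_incl[OF group_BijGroup _ subgroup_affine[OF subgroup_GammaL1 order_refl]])
  have sub: "subgroup (generate Perm ?S) Perm"
  proof (rule subgroup_generate_Perm)
    show "bij f" if "f \<in> ?S" for f
      using that subgroup_PermD(1)[OF subgroup_GammaL1] bij_translation by (auto simp: add_group_def)
  qed
  show "affine (GammaL1 p) \<subseteq> AGammaL1 p"
  proof
    fix f assume "f \<in> affine (GammaL1 p)"
    then obtain b g where f: "f = translation b \<circ> g" "g \<in> GammaL1 p" by (rule affineE)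
    have "translation b \<in> generate Perm ?S" "g \<in> generate Perm ?S"
      using f(2) by (auto simp: add_group_def intro: generate.incl)
    then show "f \<in> AGammaL1 p" unfolding f(1) AGammaL1_def by (rule subgroup_PermD(2)[OF sub])
  qed
qed

lemma stabilizer_subset_GammaL1:
  fixes G :: "('a \<Rightarrow> 'a) set"
  assumes "one_dim_affine p G"
  shows "point_stabilizer G 0 \<subseteq> GammaL1 p"
proof
  fix f assume "f \<in> point_stabilizer G (0 :: 'a)"
  then have f: "f 0 = 0" "f \<in> AGammaL1 p" using assms by (auto simp: point_stabilizer_eq one_dim_affine_def)
  then obtain b g where "f = translation b \<circ> g" "g \<in> GammaL1 p" unfolding AGammaL1_eq by (elim affineE)
  moreover obtain i u where "g = gam i u" using calculation(2) unfolding GammaL1_eq by blast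
  ultimately have "f = translation b \<circ> gam i u" by simp
  moreover have "b = 0" using f(1) calculation by (simp add: translation_def)
  ultimately have "f = gam i u" by (simp add: translation_def fun_eq_iff)
  then show "f \<in> GammaL1 p" using gam_in_GammaL1 by simp
qed

text \<open>\<open>affine K\<close> is a one-dimensional affine group of rank 4 that contains
  \<open>G\<close> and has stabilizer \<open>K\<close>, so it equals \<open>G\<close> by
  maximality.\<close>

lemma maximal_stabilizer:
  fixes G K :: "('a \<Rightarrow> 'a) set"
  assumes G: "maximal_rank4_affine p G" and K: "subgroup K Perm" "K \<subseteq> GammaL1 p"
    and sub: "point_stabilizer G 0 \<subseteq> K" and "orbit_count K = 4"
  shows "point_stabilizer G 0 = K"
proof -
  have aff: "one_dim_affine p G" using G by (simp add: maximal_rank4_affine_def)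
  define H where "H = affine K"
  have subH: "subgroup H Perm" unfolding H_def by (rule subgroup_affine[OF K])
  have addH: "add_group \<subseteq> H"
  proof
    fix f :: "'a \<Rightarrow> 'a" assume "f \<in> add_group"
    then obtain b where "f = translation b \<circ> id" by (auto simp: add_group_def)
    then show "f \<in> H" unfolding H_def by (rule affineI[OF subgroup_PermD(3)[OF K(1)]])
  qed
  have stabH: "point_stabilizer H 0 = K"
  proof (intro equalityI subsetI)
    fix f assume "f \<in> point_stabilizer H 0"
    then have "f \<in> affine K" "f 0 = 0" by (simp_all add: H_def point_stabilizer_eq)
    then obtain b g where f: "f = translation b \<circ> g" "g \<in> K" by (elim affineE)
    have "g \<in> GammaL1 p" using f(2) K(2) by blast
    then obtain i u where "g = gam i u" unfolding GammaL1_eq by blast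
    then have "b = 0" using f(1) \<open>f 0 = 0\<close> by (simp add: translation_def)
    then show "f \<in> K" using f by (simp add: translation_0)
  next
    fix f assume f: "f \<in> K"
    have "f = translation 0 \<circ> f" by (simp add: translation_0)
    then have "f \<in> H" unfolding H_def by (rule affineI[OF f])
    moreover have "f \<in> GammaL1 p" using f K(2) by blast
    then have "f 0 = 0" by (auto simp: GammaL1_eq)
    ultimately show "f \<in> point_stabilizer H 0" by (simp add: point_stabilizer_eq)
  qed
  have "one_dim_affine p H"
    unfolding one_dim_affine_def using subH addH K(2) by (auto simp: H_def AGammaL1_eq affine_def)
  moreover have "has_rank H 4"
    using rank_eq_orbit_count[OF subH addH, of 4] assms(5) by (simp add: stabH)
  moreover have "G \<subseteq> H"
  proof
    fix g assume g: "g \<in> G"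
    let ?f = "translation (- g 0) \<circ> g"
    have subG: "subgroup G Perm" "add_group \<subseteq> G" using aff by (auto simp: one_dim_affine_def)
    have "?f \<in> G" using subG g by (intro subgroup_PermD(2)[OF subG(1)]) (auto simp: add_group_def)
    then have "?f \<in> K" using sub by (auto simp: point_stabilizer_eq translation_def)
    moreover have "g = translation (g 0) \<circ> ?f" by (simp add: fun_eq_iff translation_def)
    ultimately show "g \<in> H" unfolding H_def by (rule affineI)
  qed
  ultimately have "H = G" using G by (simp add: maximal_rank4_affine_def)
  then show ?thesis using stabH by simp
qed

section \<open>Subgroups of the semilinear group and their generators\<close>

definition semidirect :: "nat \<Rightarrow> nat \<Rightarrow> nat \<Rightarrow> ('a \<Rightarrow> 'a) set"
  where "semidirect m e s = (\<Union>j. gam (e * j) ` {u. [u = s * geo (p ^ e) j] (mod m)})"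

lemma semidirectI: "[u = s * geo (p ^ e) j] (mod m) \<Longrightarrow> gam (e * j) u \<in> semidirect m e s"
  unfolding semidirect_def by blast

lemma semidirectE:
  assumes "f \<in> semidirect m e s"
  obtains j u where "f = gam (e * j) u" "[u = s * geo (p ^ e) j] (mod m)"
  using assms unfolding semidirect_def by (elim UN_E imageE CollectE)

lemma semidirect_subset: "semidirect m e s \<subseteq> GammaL1 p"
  unfolding semidirect_def GammaL1_eq by blast

lemma semidirect_cong:
  assumes "[s = s'] (mod m)"
  shows "semidirect m e s = semidirect m e s'"
proof -
  have "[u = s * geo (p ^ e) j] (mod m) \<longleftrightarrow> [u = s' * geo (p ^ e) j] (mod m)" for u j
    using cong_scalar_right[OF assms] by (meson cong_sym cong_trans)
  then show ?thesis unfolding semidirect_def by simp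
qed

lemma subgroup_semidirect: "subgroup (semidirect m e s) Perm"
proof (rule subgroup_PermI)
  show "semidirect m e s \<noteq> {}" using semidirectI[of "s * geo (p ^ e) 0" s e 0 m] by auto
  show "bij f" if "f \<in> semidirect m e s" for f
    using that by (rule semidirectE) (simp add: bij_gam)
  fix f g assume "f \<in> semidirect m e s" "g \<in> semidirect m e s"
  then obtain i u j v where f: "f = gam (e * i) u" "[u = s * geo (p ^ e) i] (mod m)"
    and g: "g = gam (e * j) v" "[v = s * geo (p ^ e) j] (mod m)"
    by (elim semidirectE)
  have "[p ^ (e * i) * v + u = p ^ (e * i) * (s * geo (p ^ e) j) + s * geo (p ^ e) i] (mod m)"
    using f(2) g(2) by (intro cong_add cong_mult cong_refl)
  then have "[p ^ (e * i) * v + u = s * geo (p ^ e) (i + j)] (mod m)"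
    by (simp add: geo_add power_mult algebra_simps)
  then show "f \<circ> g \<in> semidirect m e s"
    unfolding f(1) g(1) gam_comp distrib_left[symmetric] by (rule semidirectI)
qed

lemma q1_pos: "q - 1 > 0"
  using q_gt_1 by simp

text \<open>The element is the \<open>j\<close>-th power of \<open>gam e s\<close>. This explains
  the shape of \<open>semidirect\<close>: for \<open>m\<close> dividing \<open>q - 1\<close> it
  consists of these powers times scalings by powers of \<open>w ^ m\<close>.\<close>

lemma gam_power_mem:
  assumes "subgroup H Perm" "gam e s \<in> H"
  shows "gam (e * j) (s * geo (p ^ e) j) \<in> H"
proof (induction j)
  case 0
  then show ?case using subgroup_PermD(3)[OF assms(1)] by (simp add: id_eq_gam)
next
  case (Suc j)
  have "gam (e * j) (s * geo (p ^ e) j) \<circ> gam e s \<in> H"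
    by (rule subgroup_PermD(2)[OF assms(1) Suc assms(2)])
  then show ?case by (simp add: gam_comp geo_Suc power_mult algebra_simps)
qed

lemma gam_0_mult_mem:
  assumes "subgroup H Perm" "gam 0 n \<in> H"
  shows "gam 0 (n * i) \<in> H"
  using gam_power_mem[OF assms] by (simp add: geo_def)

lemma generate_semidirect:
  assumes "m dvd q - 1"
  shows "generate Perm {gam e s, gam 0 m} = semidirect m e s"
proof
  have 1: "gam e s \<in> semidirect m e s" using semidirectI[of s s e 1 m] by simp
  have 2: "gam 0 m \<in> semidirect m e s" using semidirectI[of m s e 0 m] by (simp add: cong_0_iff)
  show "generate Perm {gam e s, gam 0 m} \<subseteq> semidirect m e s"
    by (rule group.generate_subgroup_incl[OF group_BijGroup _ subgroup_semidirect]) (use 1 2 in blast)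
  have sub: "subgroup (generate Perm {gam e s, gam 0 m}) Perm"
    by (rule subgroup_generate_Perm) (auto simp: bij_gam)
  have gen: "gam e s \<in> generate Perm {gam e s, gam 0 m}" "gam 0 m \<in> generate Perm {gam e s, gam 0 m}"
    by (auto intro: generate.incl)
  show "semidirect m e s \<subseteq> generate Perm {gam e s, gam 0 m}"
  proof
    fix f assume "f \<in> semidirect m e s"
    then obtain j u where f: "f = gam (e * j) u" "[u = s * geo (p ^ e) j] (mod m)" by (rule semidirectE)
    let ?x = "s * geo (p ^ e) j"
    \<comment> \<open>\<open>?v\<close> is \<open>u - ?x\<close> modulo \<open>q - 1\<close> and a
      multiple of \<open>m\<close>; the scaling by \<open>w ^ ?v\<close> turns the power of
      \<open>gam e s\<close> into \<open>f\<close>.\<close>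
    let ?v = "u + (q - 1 - 1) * ?x"
    have m: "m > 0" using assms q1_pos by (auto intro: Nat.gr0I)
    have "[?x + ?v = ?x + 0] (mod m)"
      using cong_trans[OF cong_neg_nat[OF m assms q1_pos] f(2)] by (simp only: add_0_right)
    then have "m dvd ?v" by (simp only: cong_add_lcancel_nat cong_0_iff)
    then obtain i where "?v = m * i" by blast
    then have "gam 0 ?v \<in> generate Perm {gam e s, gam 0 m}"
      using gam_0_mult_mem[OF sub gen(2)] by simp
    then have "gam 0 ?v \<circ> gam (e * j) ?x \<in> generate Perm {gam e s, gam 0 m}"
      by (rule subgroup_PermD(2)[OF sub _ gam_power_mem[OF sub gen(1)]])
    moreover have "gam 0 ?v \<circ> gam (e * j) ?x = f"
      unfolding f(1) gam_comp using cong_neg_nat[OF q1_pos dvd_refl q1_pos] by (simp add: gam_cong)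
    ultimately show "f \<in> generate Perm {gam e s, gam 0 m}" by simp
  qed
qed

text \<open>Take the least positive \<open>n\<close> with the scaling by \<open>w ^ n\<close> in
  \<open>H\<close>, and the least positive Frobenius exponent \<open>e\<close> occurring in
  \<open>H\<close>. Division with remainder by both expresses every element through
  \<open>gam e s\<close> and \<open>gam 0 n\<close>.\<close>

lemma subgroup_eq_semidirect:
  assumes G: "subgroup H Perm" "H \<subseteq> GammaL1 p"
  obtains n e s where "n dvd q - 1" "n > 0" "e > 0" "H = semidirect n e s"
proof -
  let ?N = "\<lambda>n. n > 0 \<and> gam 0 n \<in> H" and ?E = "\<lambda>e. e > 0 \<and> (\<exists>s. gam e s \<in> H)"
  have id0: "gam 0 0 \<in> H" using subgroup_PermD(3)[OF G(1)] by (simp add: id_eq_gam)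
  have N: "?N (q - 1)"
  proof -
    have "gam 0 (q - 1) = gam 0 0" by (rule gam_cong) (simp add: cong_0_iff)
    then show ?thesis using id0 q1_pos by simp
  qed
  \<comment> \<open>The \<open>d\<close>-th power of the Frobenius map is the identity, so
    \<open>H\<close> contains a map with a positive exponent.\<close>
  have E: "\<exists>e. ?E e"
  proof -
    obtain d where d: "q = p ^ d" using card_power by blast
    have "gam d 0 = gam 0 0"
      unfolding gam_eq_iff d[symmetric]
    proof
      fix x
      have "[q * x = 1 * x] (mod (q - 1))"
        using q_gt_1 by (intro cong_scalar_right) (simp add: cong_altdef_nat)
      then show "[q * x + 0 = p ^ 0 * x + 0] (mod (q - 1))" by simp
    qed
    then have "gam d 0 \<in> H" using id0 by simp
    moreover have "d > 0" using d q_gt_1 by (auto intro: Nat.gr0I)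
    ultimately show ?thesis by blast
  qed
  define n where "n = (LEAST n. ?N n)"
  define e where "e = (LEAST e. ?E e)"
  have n: "n > 0" "gam 0 n \<in> H" using LeastI[of ?N, OF N] by (simp_all add: n_def)
  have e: "e > 0" "\<exists>s. gam e s \<in> H" using LeastI_ex[OF E] by (simp_all add: e_def)
  then obtain s where s: "gam e s \<in> H" by blast
  have shift: "gam i (v + (q - 1 - 1) * x) \<in> H" if "gam i v \<in> H" "gam 0 x \<in> H" for i v x
  proof -
    have "gam 0 (x * (q - 1 - 1)) \<in> H" by (rule gam_0_mult_mem[OF G(1) that(2)])
    then have "gam 0 (x * (q - 1 - 1)) \<circ> gam i v \<in> H" using subgroup_PermD(2)[OF G(1)] that(1) by blast
    then show ?thesis by (simp add: gam_comp mult.commute)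
  qed
  have dvd: "n dvd u" if u: "gam 0 u \<in> H" for u
  proof -
    let ?x = "n * (u div n)"
    have "gam 0 (u + (q - 1 - 1) * ?x) \<in> H" by (rule shift[OF u gam_0_mult_mem[OF G(1) n(2)]])
    moreover have "[u + (q - 1 - 1) * ?x = u mod n] (mod (q - 1))"
    proof -
      have "[?x + (u mod n + (q - 1 - 1) * ?x) = u mod n] (mod (q - 1))"
        by (rule cong_neg_nat[OF q1_pos dvd_refl q1_pos])
      moreover have "?x + (u mod n + (q - 1 - 1) * ?x) = u + (q - 1 - 1) * ?x"
        using mult_div_mod_eq[of n u] by linarith
      ultimately show ?thesis by simp
    qed
    ultimately have "gam 0 (u mod n) \<in> H" using gam_cong by metis
    then have "\<not> u mod n > 0"
      using not_less_Least[of "u mod n" ?N] n(1) by (auto simp: n_def[symmetric])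
    then show ?thesis by auto
  qed
  have nq: "n dvd q - 1" by (rule dvd) (use N in simp)
  have sub: "semidirect n e s \<subseteq> H"
    unfolding generate_semidirect[OF nq, symmetric]
    by (rule group.generate_subgroup_incl[OF group_BijGroup _ G(1)]) (use s n in blast)
  have "H \<subseteq> semidirect n e s"
  proof
    fix f assume f: "f \<in> H"
    then have "f \<in> GammaL1 p" using G(2) by blast
    then obtain i u where iu: "f = gam i u" unfolding GammaL1_eq by blast
    let ?j = "i div e" and ?r = "i mod e"
    define h where "h = gam (e * ?j) (s * geo (p ^ e) ?j)"
    have h: "h \<in> H" unfolding h_def by (rule gam_power_mem[OF G(1) s])
    \<comment> \<open>Removing the power \<open>h\<close> of \<open>gam e s\<close> from
      \<open>f\<close> leaves \<open>gam ?r v\<close>, where \<open>v\<close> is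
      \<open>u - x\<close> modulo \<open>q - 1\<close>; minimality of \<open>e\<close> then makes
      \<open>?r\<close> zero.\<close>
    define x where "x = p ^ ?r * (s * geo (p ^ e) ?j)"
    define v where "v = u + (q - 1 - 1) * x"
    have eq: "gam ?r v \<circ> h = f"
    proof -
      have "gam ?r v \<circ> h = gam (?r + e * ?j) (x + v)" by (simp add: h_def gam_comp x_def)
      also have "?r + e * ?j = i" by (rule mod_mult_div_eq)
      also have "gam i (x + v) = gam i u" unfolding v_def
        by (intro gam_cong cong_neg_nat[OF q1_pos dvd_refl q1_pos])
      finally show ?thesis by (simp only: iu)
    qed
    have "f (inv_into UNIV h z) = gam ?r v z" for z
      using fun_cong[OF eq, of "inv_into UNIV h z"] subgroup_PermD(1)[OF G(1) h]
      by (simp add: bij_is_surj surj_f_inv_f)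
    then have "f \<circ> inv_into UNIV h = gam ?r v" by (simp add: fun_eq_iff)
    then have rv: "gam ?r v \<in> H" using subgroup_PermD(2,4)[OF G(1)] f h by metis
    have "?r = 0"
    proof (rule ccontr)
      assume "?r \<noteq> 0"
      then have "?E ?r" using rv by blast
      moreover have "?r < e" using e(1) by simp
      ultimately show False using not_less_Least[of ?r ?E] by (simp only: e_def[symmetric])
    qed
    then have r: "i = e * ?j" using mult_div_mod_eq[of e i] by simp
    have "n dvd v" using rv \<open>?r = 0\<close> dvd by simp
    have "[u = s * geo (p ^ e) ?j] (mod n)"
    proof -
      have "[x + v = u] (mod n)" unfolding v_def by (rule cong_neg_nat[OF n(1) nq q1_pos])
      moreover have "[x + v = x + 0] (mod n)"
        using \<open>n dvd v\<close> by (intro cong_add cong_refl) (simp add: cong_0_iff)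
      moreover have "x = s * geo (p ^ e) ?j" using \<open>?r = 0\<close> by (simp add: x_def)
      ultimately show ?thesis by (metis add_0_right cong_sym cong_trans)
    qed
    then have "gam (e * ?j) u \<in> semidirect n e s" by (rule semidirectI)
    then show "f \<in> semidirect n e s" using r iu by simp
  qed
  then show thesis using that[OF nq n(1) e(1)] sub by blast
qed

text \<open>Powers of \<open>gam e s\<close> move the exponent along its cycle modulo
  \<open>m\<close>, and the scalings in the group fill up each residue class.\<close>

lemma orbit_semidirect:
  assumes "m dvd q - 1"
  shows "(\<lambda>g. g (w ^ x)) ` semidirect m e s = (\<lambda>y. w ^ y) ` {y. y mod m \<in> aorb (p ^ e) s m x}"
proof (intro equalityI subsetI)
  fix z assume "z \<in> (\<lambda>g. g (w ^ x)) ` semidirect m e s"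
  then obtain g where "z = g (w ^ x)" "g \<in> semidirect m e s" by (rule imageE)
  then obtain j u where u: "z = gam (e * j) u (w ^ x)" "[u = s * geo (p ^ e) j] (mod m)"
    by (elim semidirectE) simp
  have "[p ^ (e * j) * x + u = aff (p ^ e) s j x] (mod m)"
    unfolding aff_def power_mult by (intro cong_add cong_refl u(2))
  then have "(p ^ (e * j) * x + u) mod m \<in> aorb (p ^ e) s m x"
    unfolding aorb_def cong_def by (rule range_eqI)
  then show "z \<in> (\<lambda>y. w ^ y) ` {y. y mod m \<in> aorb (p ^ e) s m x}"
    unfolding u(1) gam_power by blast
next
  fix z assume "z \<in> (\<lambda>y. w ^ y) ` {y. y mod m \<in> aorb (p ^ e) s m x}"
  then obtain y where y: "z = w ^ y" "y mod m \<in> aorb (p ^ e) s m x" by blast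
  then obtain j where j: "[y = aff (p ^ e) s j x] (mod m)" unfolding aorb_def cong_def by (elim rangeE)
  have m: "m > 0" using assms q1_pos by (auto intro: Nat.gr0I)
  define u where "u = y + (q - 1 - 1) * (p ^ (e * j) * x)"
  have *: "[p ^ (e * j) * x + u = y] (mod (q - 1))"
    unfolding u_def by (rule cong_neg_nat[OF q1_pos dvd_refl q1_pos])
  then have "[p ^ (e * j) * x + u = p ^ (e * j) * x + s * geo (p ^ e) j] (mod m)"
    using cong_trans[OF cong_dvd_modulus_nat[OF * assms] j] by (simp add: aff_def power_mult)
  then have "gam (e * j) u \<in> semidirect m e s" by (intro semidirectI) (simp only: cong_add_lcancel_nat)
  moreover have "z = gam (e * j) u (w ^ x)"
    unfolding y(1) gam_power using * power_eq_iff by metis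
  ultimately show "z \<in> (\<lambda>g. g (w ^ x)) ` semidirect m e s"
    by (intro image_eqI[of z "\<lambda>g. g (w ^ x)" "gam (e * j) u"])
qed

text \<open>Orbits on powers of \<open>w\<close> correspond to cycles modulo \<open>m\<close>; the
  additional orbit is that of 0.\<close>

lemma orbit_count_semidirect:
  assumes "m dvd q - 1"
  shows "orbit_count (semidirect m e s) = norb (p ^ e) s m + 1"
proof -
  have m: "m > 0" using assms q1_pos by (auto intro: Nat.gr0I)
  let ?H = "semidirect m e s"
  let ?O = "\<lambda>z. (\<lambda>g. g z) ` ?H"
  let ?U = "\<lambda>X. (\<lambda>y. w ^ y) ` {y. y mod m \<in> X}"
  have zero: "?O 0 = {0}"
  proof -
    have "g 0 = 0" if "g \<in> ?H" for g using that by (rule semidirectE) simp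
    moreover have "id \<in> ?H" by (rule subgroup_PermD(3)[OF subgroup_semidirect])
    ultimately show ?thesis by (auto simp: image_iff)
  qed
  have "UNIV = insert 0 (range (\<lambda>x. w ^ x))"
    using primitive unfolding primitive_element_def by auto
  then have "range ?O = ?O ` insert 0 (range (\<lambda>x. w ^ x))" by (rule arg_cong)
  also have "\<dots> = insert (?O 0) (?O ` range (\<lambda>x. w ^ x))" by (rule image_insert)
  also have "?O ` range (\<lambda>x. w ^ x) = ?U ` range (aorb (p ^ e) s m)"
    unfolding image_image orbit_semidirect[OF assms] ..
  also have "range (aorb (p ^ e) s m) = aorb (p ^ e) s m ` {..<m}"
    by (rule aorb_image_lessThan[OF m, symmetric])
  finally have eq: "range ?O = insert {0} (?U ` (aorb (p ^ e) s m ` {..<m}))" by (simp only: zero)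
  \<comment> \<open>Equal powers of \<open>w\<close> have exponents congruent modulo
    \<open>q - 1\<close>, hence modulo \<open>m\<close>, so a set of residues is recovered from its
    powers.\<close>
  have inj: "inj_on ?U (Pow {..<m})"
  proof (rule inj_onI)
    have sub: "X \<subseteq> Y" if XY: "X \<in> Pow {..<m}" "?U X = ?U Y" for X Y
    proof
      fix x assume x: "x \<in> X"
      then have xm: "x mod m = x" using XY(1) by auto
      then have "w ^ x \<in> ?U X" using x by (intro imageI) simp
      then obtain y where y: "w ^ x = w ^ y" "y mod m \<in> Y" unfolding XY(2) by blast
      have "[x = y] (mod m)" using y(1) assms cong_dvd_modulus_nat power_eq_iff by blast
      then show "x \<in> Y" using y(2) xm by (simp add: cong_def)
    qed
    fix X Y assume "X \<in> Pow {..<m}" "Y \<in> Pow {..<m}" "?U X = ?U Y"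
    then show "X = Y" using sub[of X Y] sub[of Y X] by simp
  qed
  have "aorb (p ^ e) s m ` {..<m} \<subseteq> Pow {..<m}" using aorb_subset[OF m] by blast
  then have "card (?U ` (aorb (p ^ e) s m ` {..<m})) = norb (p ^ e) s m"
    unfolding norb_def by (intro card_image inj_on_subset[OF inj])
  moreover have "{0} \<notin> ?U ` (aorb (p ^ e) s m ` {..<m})"
  proof
    assume "{0} \<in> ?U ` (aorb (p ^ e) s m ` {..<m})"
    then obtain X where X: "{0} = ?U X" by blast
    have "0 \<in> ?U X" by (rule equalityD1[OF X, THEN subsetD]) simp
    then show False using w_nonzero by auto
  qed
  ultimately show ?thesis unfolding orbit_count_def eq by simp
qed

section \<open>The classification\<close>

text \<open>The counterpart of \<open>norb_translate\<close> for groups: the scaling by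
  \<open>w ^ t\<close> shifts exponents by \<open>t\<close>. The identity
  \<open>p ^ (e * j) - 1 = (p ^ e - 1) * geo (p ^ e) j\<close> makes the change of \<open>s\<close>
  the same for all \<open>j\<close>.\<close>

lemma conjugate_semidirect:
  assumes "m dvd q - 1"
  shows "(\<lambda>f. gam 0 ((q - 1 - 1) * t) \<circ> f \<circ> gam 0 t) ` semidirect m e s =
    semidirect m e (s + (p ^ e - 1) * t)"
proof -
  have m: "m > 0" using assms q1_pos by (auto intro: Nat.gr0I)
  let ?c = "\<lambda>f. gam 0 ((q - 1 - 1) * t) \<circ> f \<circ> gam 0 t"
  have conj: "?c (gam i u) = gam i (u + (p ^ i - 1) * t)" for i u
  proof -
    have "?c (gam i u) = gam i (p ^ i * t + (u + (q - 1 - 1) * t))"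
      by (simp add: gam_comp)
    also have "p ^ i * t + (u + (q - 1 - 1) * t) = t + (u + (p ^ i - 1) * t + (q - 1 - 1) * t)"
    proof -
      have "p ^ i * t = t + (p ^ i - 1) * t"
        by (metis One_nat_def Suc_leI add_mult_distrib le_add_diff_inverse mult_1 one_le_power p_pos)
      then show ?thesis by simp
    qed
    also have "gam i \<dots> = gam i (u + (p ^ i - 1) * t)"
      by (intro gam_cong cong_neg_nat[OF q1_pos dvd_refl q1_pos])
    finally show ?thesis .
  qed
  have geo: "p ^ (e * j) - 1 = (p ^ e - 1) * geo (p ^ e) j" for j
    using geo_eq_power[of "p ^ e" j] by (simp add: power_mult)
  have iff: "[u + (p ^ (e * j) - 1) * t = (s + (p ^ e - 1) * t) * geo (p ^ e) j] (mod m) \<longleftrightarrow>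
      [u = s * geo (p ^ e) j] (mod m)" for u j
  proof -
    have "(s + (p ^ e - 1) * t) * geo (p ^ e) j = s * geo (p ^ e) j + (p ^ (e * j) - 1) * t"
      unfolding geo by (simp add: distrib_left distrib_right mult_ac)
    then show ?thesis by (simp only: cong_add_rcancel_nat)
  qed
  show ?thesis
  proof (intro equalityI subsetI)
    fix f assume "f \<in> ?c ` semidirect m e s"
    then obtain g where "f = ?c g" "g \<in> semidirect m e s" by (rule imageE)
    then obtain j u where "f = ?c (gam (e * j) u)" "[u = s * geo (p ^ e) j] (mod m)"
      by (elim semidirectE) simp
    then show "f \<in> semidirect m e (s + (p ^ e - 1) * t)"
      unfolding conj by (simp only: semidirectI iff)
  next
    fix f assume "f \<in> semidirect m e (s + (p ^ e - 1) * t)"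
    then obtain j v where f: "f = gam (e * j) v" "[v = (s + (p ^ e - 1) * t) * geo (p ^ e) j] (mod m)"
      by (rule semidirectE)
    define u where "u = v + (q - 1 - 1) * ((p ^ (e * j) - 1) * t)"
    have *: "[u + (p ^ (e * j) - 1) * t = v] (mod (q - 1))"
      unfolding u_def by (subst add.commute) (rule cong_neg_nat[OF q1_pos dvd_refl q1_pos])
    then have "[u + (p ^ (e * j) - 1) * t = (s + (p ^ e - 1) * t) * geo (p ^ e) j] (mod m)"
      using cong_trans[OF cong_dvd_modulus_nat[OF _ assms] f(2)] by blast
    then have "gam (e * j) u \<in> semidirect m e s" unfolding iff by (rule semidirectI)
    moreover have "f = ?c (gam (e * j) u)" unfolding conj f(1) by (rule gam_cong[OF *, symmetric])
    ultimately show "f \<in> ?c ` semidirect m e s"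
      by (intro image_eqI[of f ?c "gam (e * j) u"])
  qed
qed

lemma inv_gam_0: "inv_into UNIV (gam 0 ((q - 1 - 1) * t)) = gam 0 t"
proof -
  have "[t + (0 + (q - 1 - 1) * t) = 0] (mod (q - 1))" by (rule cong_neg_nat[OF q1_pos dvd_refl q1_pos])
  then have "gam 0 (t + (q - 1 - 1) * t) = id" unfolding id_eq_gam by (intro gam_cong) simp
  then have "gam 0 ((q - 1 - 1) * t) \<circ> gam 0 t = id" by (simp add: gam_comp)
  then have "gam 0 ((q - 1 - 1) * t) (gam 0 t x) = x" for x by (metis comp_apply id_apply)
  then have "inv_into UNIV (gam 0 ((q - 1 - 1) * t)) x = gam 0 t x" for x
    by (intro inv_f_eq bij_is_inj bij_gam)
  then show ?thesis by blast
qed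

text \<open>The congruence says that, after moving \<open>t\<close> to 0, \<open>gam e s\<close>
  agrees modulo \<open>m\<close> with the \<open>f\<close>-th power of \<open>gam e' s'\<close>. So
  the stabilizer lies in a conjugate of \<open>semidirect m e' s'\<close>. The larger group has at
  most four orbits, the bound on \<open>norb\<close> gives at least four, and maximality yields
  equality.\<close>

lemma embedding_conjugate:
  assumes G: "maximal_rank4_affine p G" and G0: "point_stabilizer G 0 = semidirect n e s"
    and n: "n dvd q - 1" "norb (p ^ e) s n = 3"
    and m: "m dvd n" and e: "e = e' * f"
    and s: "[s + (p ^ e - 1) * t = s' * geo (p ^ e') f] (mod m)"
    and norb: "norb (p ^ e') s' m \<ge> 3"
  shows "conjugate_in (GammaL1 p) (point_stabilizer G 0) (semidirect m e' s')"
proof -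
  have mq: "m dvd q - 1" using m n(1) by (rule dvd_trans)
  have m0: "m > 0" using mq q1_pos by (auto intro: Nat.gr0I)
  \<comment> \<open>Conjugating the target back by \<open>- t\<close> makes it contain the
    stabilizer itself.\<close>
  define s'' where "s'' = s' + (p ^ e' - 1) * ((q - 1 - 1) * t)"
  let ?K = "semidirect m e' s''"
  have s'': "[s = s'' * geo (p ^ e') f] (mod m)"
  proof -
    have "p ^ e - 1 = (p ^ e' - 1) * geo (p ^ e') f"
      using geo_eq_power[of "p ^ e'" f] by (simp add: e power_mult)
    then have "s'' * geo (p ^ e') f = s' * geo (p ^ e') f + (q - 1 - 1) * ((p ^ e - 1) * t)"
      by (simp add: s''_def distrib_left distrib_right mult_ac)
    then have "[(p ^ e - 1) * t + s'' * geo (p ^ e') f = s' * geo (p ^ e') f] (mod m)"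
      by (simp only: cong_neg_nat[OF m0 mq q1_pos])
    then have "[(p ^ e - 1) * t + s = (p ^ e - 1) * t + s'' * geo (p ^ e') f] (mod m)"
      using s by (metis add.commute cong_sym cong_trans)
    then show ?thesis by (simp only: cong_add_lcancel_nat)
  qed
  have sub: "semidirect n e s \<subseteq> ?K"
  proof
    fix g assume "g \<in> semidirect n e s"
    then obtain j u where g: "g = gam (e * j) u" "[u = s * geo (p ^ e) j] (mod n)" by (rule semidirectE)
    have "[u = s * geo (p ^ e) j] (mod m)" using g(2) m by (rule cong_dvd_modulus_nat)
    also have "[s * geo (p ^ e) j = s'' * geo (p ^ e') f * geo (p ^ e) j] (mod m)"
      by (rule cong_scalar_right[OF s''])
    also have "s'' * geo (p ^ e') f * geo (p ^ e) j = s'' * geo (p ^ e') (f * j)"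
      by (simp add: geo_mult e power_mult)
    finally have "gam (e' * (f * j)) u \<in> ?K" by (rule semidirectI)
    then show "g \<in> ?K" by (simp add: g(1) e mult.assoc)
  qed
  have "norb (p ^ e') s'' m = norb (p ^ e') s' m"
    unfolding s''_def using m0 by (intro norb_translate) simp_all
  then have "orbit_count ?K \<ge> 4" using norb by (simp add: orbit_count_semidirect[OF mq])
  moreover have "orbit_count ?K \<le> 4"
    using orbit_count_antimono[OF subgroup_semidirect subgroup_semidirect sub]
    by (simp add: orbit_count_semidirect[OF n(1)] n(2))
  ultimately have K: "point_stabilizer G 0 = ?K"
    using maximal_stabilizer[OF G subgroup_semidirect semidirect_subset] sub by (simp add: G0)
  have "[(p ^ e' - 1) * t + (s' + (q - 1 - 1) * ((p ^ e' - 1) * t)) = s'] (mod m)"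
    by (rule cong_neg_nat[OF m0 mq q1_pos])
  then have "[s'' + (p ^ e' - 1) * t = s'] (mod m)" by (simp add: s''_def add_ac mult.left_commute)
  then have "semidirect m e' s' = (\<lambda>f. gam 0 ((q - 1 - 1) * t) \<circ> f \<circ> gam 0 t) ` ?K"
    unfolding conjugate_semidirect[OF mq] by (rule semidirect_cong[symmetric])
  then have "\<exists>g\<in>GammaL1 p. semidirect m e' s' = (\<lambda>h. g \<circ> h \<circ> inv_into UNIV g) ` ?K"
    by (intro bexI[OF _ gam_in_GammaL1[of 0 "(q - 1 - 1) * t"]]) (simp only: inv_gam_0)
  moreover have "bij g" if "g \<in> GammaL1 p" for g :: "'a \<Rightarrow> 'a"
    using that subgroup_PermD(1)[OF subgroup_GammaL1] by blast
  moreover have "bij g" if "g \<in> ?K" for g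
    using that subgroup_PermD(1)[OF subgroup_semidirect] by blast
  ultimately show ?thesis unfolding K by (subst conjugate_in_Perm)
qed

section \<open>Existence of a listed group\<close>

definition listed :: "nat \<Rightarrow> nat \<Rightarrow> ('a \<Rightarrow> 'a) set \<Rightarrow> bool"
  where "listed i r H \<longleftrightarrow>
    (i = 1 \<and> r \<noteq> 2 \<and> ord r p = (r - 1) div 2 \<and>
       conjugate_in (GammaL1 p) H (generate Perm {frob p, scaling (w ^ r)})) \<or>
    (i = 2 \<and> r \<noteq> 2 \<and> ord r p = r - 1 \<and>
       conjugate_in (GammaL1 p) H (generate Perm {frob p [^]\<^bsub>Perm\<^esub> (2::nat), scaling (w ^ r)})) \<or>
    (i = 3 \<and> r\<^sup>2 dvd q - 1 \<and> ord (r\<^sup>2) p = r\<^sup>2 - r \<and>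
       conjugate_in (GammaL1 p) H (generate Perm {frob p, scaling (w ^ r\<^sup>2)})) \<or>
    (i = 4 \<and> odd p \<and> r \<noteq> 2 \<and> ord r p = r - 1 \<and>
       conjugate_in (GammaL1 p) H
         (generate Perm {scaling (w ^ r) \<otimes>\<^bsub>Perm\<^esub> frob p, scaling (w ^ (2 * r))}))"

lemma generate_listed:
  assumes "m dvd q - 1"
  shows "generate Perm {frob p, scaling (w ^ m)} = semidirect m 1 0"
    and "generate Perm {frob p [^]\<^bsub>Perm\<^esub> (2::nat), scaling (w ^ m)} = semidirect m 2 0"
    and "generate Perm {scaling (w ^ s) \<otimes>\<^bsub>Perm\<^esub> frob p, scaling (w ^ m)} = semidirect m 1 s"
  using generate_semidirect[OF assms]
  by (simp_all only: scaling_frob_eq_gam frob_square_eq_gam) (simp_all only: frob_eq_gam scaling_eq_gam)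

text \<open>The cases of \<open>three_orbits\<close> for the multiplier \<open>p ^ e\<close>, with
  orders of \<open>p ^ e\<close> turned into orders of \<open>p\<close>. A prime leads to types 1 or
  2, a square to type 3, a doubled prime to type 4.\<close>

lemma listed_exists:
  assumes G: "maximal_rank4_affine p G"
  shows "\<exists>i\<in>{1..4}. \<exists>r\<in>prime_factors (q - 1). listed i r (point_stabilizer G 0)"
proof -
  let ?G0 = "point_stabilizer G 0"
  have aff: "one_dim_affine p G" "has_rank G 4" using G by (simp_all add: maximal_rank4_affine_def)
  then have subG: "subgroup G Perm" "add_group \<subseteq> G" by (simp_all add: one_dim_affine_def)
  obtain n e s where n: "n dvd q - 1" "n > 0" "e > 0" and G0: "?G0 = semidirect n e s"
    using subgroup_eq_semidirect[OF subgroup_point_stabilizer[OF subG(1)] stabilizer_subset_GammaL1[OF aff(1)]] .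
  have norb: "norb (p ^ e) s n = 3"
    using rank_eq_orbit_count[OF subG, of 4] aff(2) by (simp add: G0 orbit_count_semidirect[OF n(1)])
  note embed = embedding_conjugate[OF G G0 n(1) norb]
  have cop_n: "coprime p n" using coprime_p n(1) by (meson coprime_divisors dvd_refl)
  have cop: "coprime p r" if "r dvd n" for r using cop_n that by (meson coprime_divisors dvd_refl)
  have pf: "r \<in> prime_factors (q - 1)" if "prime r" "r dvd n" for r
    using that(1) dvd_trans[OF that(2) n(1)] q1_pos by (simp add: in_prime_factors_iff)
  have ord_pow: "ord m (p ^ e) = ord m p div gcd e (ord m p)" if "m dvd n" for m
    using cop[OF that] by (intro ord_power) (simp add: coprime_commute)
  have ord_dvd: "ord m p dvd totient m" if "m dvd n" for m
    using cop[OF that] by (intro order_divides_totient) (simp add: coprime_commute)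
  have max_ord: "ord m p = totient m" if "m dvd n" "ord m (p ^ e) = totient m" for m
  proof (rule dvd_antisym[OF ord_dvd[OF that(1)]])
    have "ord m p div gcd e (ord m p) * gcd e (ord m p) = ord m p"
      by (rule dvd_div_mult_self) (rule gcd_dvd2)
    then have "ord m p = totient m * gcd e (ord m p)"
      by (simp only: ord_pow[OF that(1), symmetric] that(2))
    then show "totient m dvd ord m p" by (rule dvdI)
  qed
  have pe: "coprime (p ^ e) n" "p ^ e > 0" using cop_n by simp_all
  show ?thesis using n(2) pe norb
  proof (cases rule: three_orbits)
    case (prime r t)
    note r = prime
    have r2: "r > 2" using r(1,3) prime_ge_2_nat[of r] by simp
    have oddr: "odd r" using r(1) r2 by (simp add: prime_odd_nat)
    define h where "h = (r - 1) div 2"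
    have h: "r - 1 = 2 * h" "h > 0" using oddr r2 by (auto simp: h_def elim!: oddE)
    \<comment> \<open>\<open>g\<close> is the factor by which the order drops from \<open>p\<close>
      to \<open>p ^ e\<close>. As \<open>h * g\<close> divides \<open>2 * h\<close>, it is 1 (type
      1) or 2 (type 2, with \<open>e\<close> even).\<close>
    define g where "g = gcd e (ord r p)"
    have "ord r p = h * g"
      using ord_pow[OF r(2)] r(5) by (simp add: g_def h_def)
    moreover have "ord r p dvd 2 * h" using ord_dvd[OF r(2)] r(1) h(1) by (simp add: totient_prime)
    ultimately have "g dvd 2" using h(2) by (simp add: mult.commute)
    then have "g = 1 \<or> g = 2" using two_is_prime_nat by (auto simp: prime_nat_iff)
    then show ?thesis
    proof
      assume "g = 1"
      then have o: "ord r p = (r - 1) div 2" using \<open>ord r p = h * g\<close> by (simp add: h_def)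
      have "conjugate_in (GammaL1 p) ?G0 (semidirect r 1 0)"
        by (rule embed[OF r(2), of 1 e t 0])
          (use r cop[OF r(2)] norb_half[OF r(1,3) _ o] in \<open>simp_all add: cong_0_iff\<close>)
      then have "listed 1 r ?G0" unfolding listed_def
        using r(3) o dvd_trans[OF r(2) n(1)] by (simp add: generate_listed)
      then show ?thesis using pf[OF r(1,2)] by (intro bexI[of _ 1] bexI[of _ r]) auto
    next
      assume "g = 2"
      then have o: "ord r p = r - 1" and "even e" using \<open>ord r p = h * g\<close> h(1) unfolding g_def
        by (simp, metis gcd_dvd1)
      then obtain f where f: "e = 2 * f" by blast
      have cr: "coprime r p" using cop[OF r(2)] by (simp add: coprime_commute)
      have "gcd 2 (r - 1) = 2" using h(1) by simp
      then have "ord r (p ^ 2) = (r - 1) div 2" using ord_power[OF cr, of 2] o by simp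
      then have nh: "norb (p ^ 2) 0 r = 3" using cop[OF r(2)] by (intro norb_half r(1,3)) simp_all
      have "conjugate_in (GammaL1 p) ?G0 (semidirect r 2 0)"
        by (rule embed[OF r(2), of 2 f t 0]) (use r f nh in \<open>simp_all add: cong_0_iff\<close>)
      then have "listed 2 r ?G0" unfolding listed_def
        using r(3) o dvd_trans[OF r(2) n(1)] by (simp add: generate_listed)
      then show ?thesis using pf[OF r(1,2)] by (intro bexI[of _ 2] bexI[of _ r]) auto
    qed
  next
    case (square r t)
    note r = square
    have r1: "r > 1" using r(1) by (rule prime_gt_1_nat)
    have rn: "r dvd n" using r(2) by (auto simp: power2_eq_square intro: dvd_mult_left)
    have "totient (r\<^sup>2) = r\<^sup>2 - r"
      using totient_prime_power[OF r(1), of 2] by (simp add: power2_eq_square diff_mult_distrib2)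
    then have o: "ord (r\<^sup>2) p = r\<^sup>2 - r" using max_ord[OF r(2)] r(4) by simp
    \<comment> \<open>These three divisors lie on distinct cycles of multiplication by
      \<open>p\<close>.\<close>
    have "card {1, r, r\<^sup>2} = 3" using r1 by (simp add: power2_eq_square)
    moreover have "card {1, r, r\<^sup>2} \<le> card {d. d dvd r\<^sup>2}"
      using r1 by (intro card_mono finite_divisors_nat) auto
    moreover have "card {d. d dvd r\<^sup>2} \<le> norb p 0 (r\<^sup>2)"
      using r1 cop[OF rn] card_divisors_le_norb[of "r\<^sup>2" p 0 0] by simp
    ultimately have nr: "norb p 0 (r\<^sup>2) \<ge> 3" by linarith
    have "conjugate_in (GammaL1 p) ?G0 (semidirect (r\<^sup>2) 1 0)"
      by (rule embed[OF r(2), of 1 e t 0]) (use r nr in \<open>simp_all add: cong_0_iff\<close>)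
    then have "listed 3 r ?G0" unfolding listed_def
      using o dvd_trans[OF r(2) n(1)] by (simp add: generate_listed)
    then show ?thesis using pf[OF r(1) rn] by (intro bexI[of _ 3] bexI[of _ r]) auto
  next
    case (double r t)
    note r = double
    have r2: "r > 2" using r(1,3) prime_ge_2_nat[of r] by simp
    have oddr: "odd r" using r(1) r2 by (simp add: prime_odd_nat)
    have rn: "r dvd n" using r(2) by (rule dvd_mult_right)
    have oddp: "odd p" using r(4) n(3) by simp
    have o: "ord r p = r - 1" using max_ord[OF rn] r(1,7) by (simp add: totient_prime)
    \<comment> \<open>An even \<open>e\<close> shares the factor 2 with
      \<open>ord r p = r - 1\<close>, which would give \<open>p ^ e\<close> a smaller order.\<close>
    have "odd e"
    proof
      assume "even e"
      then have "2 dvd gcd e (r - 1)" using oddr by simp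
      then have "gcd e (r - 1) \<ge> 2" using r2 by (intro dvd_imp_le) auto
      moreover have "(r - 1) div gcd e (r - 1) = r - 1" using ord_pow[OF rn] r(7) o by simp
      ultimately show False using r2 div_less_dividend[of "gcd e (r - 1)" "r - 1"] by simp
    qed
    \<comment> \<open>Modulo \<open>r\<close> both sides vanish; modulo 2 both are odd, since
      \<open>geo p e\<close> is a sum of an odd number of odd terms.\<close>
    have "[s + (p ^ e - 1) * t = r * geo (p ^ 1) e] (mod 2 * r)"
    proof (rule coprime_cong_mult_nat)
      show "coprime 2 r" using oddr by (simp add: coprime_left_2_iff_odd)
      have "[s + (p ^ e - 1) * t = 0] (mod r)" using r(6) by (simp add: cong_0_iff)
      moreover have "[r * geo (p ^ 1) e = 0] (mod r)" by (simp add: cong_0_iff)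
      ultimately show "[s + (p ^ e - 1) * t = r * geo (p ^ 1) e] (mod r)" by (metis cong_sym cong_trans)
      have "[geo p e = e] (mod 2)"
        using oddp by (intro geo_cong_1) (simp add: cong_def odd_iff_mod_2_eq_one)
      then have "odd (geo p e)" using \<open>odd e\<close> cong_dvd_iff by blast
      then have "odd (r * geo (p ^ 1) e)" using oddr by simp
      moreover have "odd (s + (p ^ e - 1) * t)" using r(4,5) by simp
      ultimately show "[s + (p ^ e - 1) * t = r * geo (p ^ 1) e] (mod 2)"
        unfolding cong_def odd_iff_mod_2_eq_one by (simp only:)
    qed
    moreover have "norb p r (2 * r) \<ge> 3"
      by (rule norb_double_prime[OF r(1) oddr oddp cop[OF rn] o])
    ultimately have "conjugate_in (GammaL1 p) ?G0 (semidirect (2 * r) 1 r)"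
      by (intro embed[OF r(2), of 1 e t r]) simp_all
    then have "listed 4 r ?G0" unfolding listed_def
      using r(3) o oddp dvd_trans[OF r(2) n(1)] by (simp add: generate_listed)
    then show ?thesis using pf[OF r(1) rn] by (intro bexI[of _ 4] bexI[of _ r]) auto
  qed
qed

text \<open>Conjugation by an element of \<open>GammaL1\<close> acts on scalings as a power of the Frobenius map.\<close>

lemma conjugate_scalings:
  assumes H: "subgroup H Perm" and conj: "conjugate_in (GammaL1 p) H K" and m: "m dvd q - 1"
    and K: "\<And>u. gam 0 u \<in> K \<longleftrightarrow> m dvd u"
  shows "gam 0 u \<in> H \<longleftrightarrow> m dvd u"
proof -
  have "bij g" if "g \<in> GammaL1 p" for g :: "'a \<Rightarrow> 'a"
    using that subgroup_PermD(1)[OF subgroup_GammaL1] by blast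
  moreover have "bij g" if "g \<in> H" for g using that subgroup_PermD(1)[OF H] by blast
  ultimately have "\<exists>g\<in>GammaL1 p. K = (\<lambda>h. g \<circ> h \<circ> inv_into UNIV g) ` H"
    using conj by (subst (asm) conjugate_in_Perm)
  then obtain i v where Keq: "K = (\<lambda>h. gam i v \<circ> h \<circ> inv_into UNIV (gam i v)) ` H"
    unfolding GammaL1_eq by blast
  let ?g = "gam i v"
  have inv1: "inv_into UNIV ?g (?g x) = x" for x by (rule inv_f_f[OF bij_is_inj[OF bij_gam]])
  have inv2: "?g (inv_into UNIV ?g x) = x" for x by (rule surj_f_inv_f[OF bij_is_surj[OF bij_gam]])
  have comm: "?g (gam 0 u x) = gam 0 (p ^ i * u) (?g x)" for x
  proof -
    have "?g \<circ> gam 0 u = gam 0 (p ^ i * u) \<circ> ?g" by (simp add: gam_comp add.commute)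
    then show ?thesis by (metis comp_apply)
  qed
  have "gam 0 (p ^ i * u) \<in> K \<longleftrightarrow> gam 0 u \<in> H"
  proof
    assume "gam 0 u \<in> H"
    then have "?g \<circ> gam 0 u \<circ> inv_into UNIV ?g \<in> K" unfolding Keq by (rule imageI)
    moreover have "?g \<circ> gam 0 u \<circ> inv_into UNIV ?g = gam 0 (p ^ i * u)"
      by (simp add: fun_eq_iff comm inv2)
    ultimately show "gam 0 (p ^ i * u) \<in> K" by simp
  next
    assume "gam 0 (p ^ i * u) \<in> K"
    then obtain h where h: "gam 0 (p ^ i * u) = ?g \<circ> h \<circ> inv_into UNIV ?g" "h \<in> H"
      unfolding Keq by (rule imageE)
    have "?g (h x) = ?g (gam 0 u x)" for x
      using fun_cong[OF h(1), of "?g x"] by (simp add: inv1 comm)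
    then have "h = gam 0 u" using bij_is_inj[OF bij_gam, of i v] by (auto simp: fun_eq_iff inj_eq)
    then show "gam 0 u \<in> H" using h(2) by simp
  qed
  \<comment> \<open>Conjugation multiplies the exponent of a scaling by \<open>p ^ i\<close>, a unit
    modulo \<open>m\<close>, so divisibility by \<open>m\<close> is unaffected.\<close>
  moreover have "coprime m (p ^ i)" using coprime_p m
    by (metis coprime_commute coprime_divisors coprime_power_right_iff dvd_refl)
  ultimately show ?thesis unfolding K by (simp add: coprime_dvd_mult_right_iff)
qed

section \<open>Scalings as invariants that separate the listed groups\<close>

lemma scalings_semidirect_0:
  assumes "m dvd q - 1"
  shows "gam 0 u \<in> semidirect m e 0 \<longleftrightarrow> m dvd u"
proof
  assume "gam 0 u \<in> semidirect m e 0"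
  then obtain j v where v: "gam 0 u = gam (e * j) v" "[v = 0] (mod m)" by (rule semidirectE) simp
  \<comment> \<open>A scaling may also be written with \<open>j > 0\<close>; comparing the images of
    \<open>w ^ 0\<close> still identifies \<open>u\<close> and \<open>v\<close>.\<close>
  have "[p ^ 0 * 0 + u = p ^ (e * j) * 0 + v] (mod (q - 1))" using v(1) gam_eq_iff by blast
  then have "[u = v] (mod m)" using assms by (simp add: cong_dvd_modulus_nat)
  then show "m dvd u" using v(2) cong_trans cong_0_iff by blast
next
  assume "m dvd u"
  then show "gam 0 u \<in> semidirect m e 0" using semidirectI[of u 0 e 0 m] by (simp add: cong_0_iff)
qed

text \<open>If \<open>gam j v\<close> is a scaling, then \<open>p ^ j\<close> is 1 modulo
  \<open>r\<close>, so the even number \<open>r - 1\<close> divides \<open>j\<close>. Then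
  \<open>geo p j\<close> is even and \<open>r * geo p j\<close> is a multiple of
  \<open>2 * r\<close>: powers of \<open>gam 1 r\<close> add no further scalings.\<close>

lemma scalings_semidirect_double:
  assumes "odd r" "odd p" "2 * r dvd q - 1" "ord r p = r - 1"
  shows "gam 0 u \<in> semidirect (2 * r) 1 r \<longleftrightarrow> 2 * r dvd u"
proof
  assume "gam 0 u \<in> semidirect (2 * r) 1 r"
  then obtain j v where v: "gam 0 u = gam j v" "[v = r * geo p j] (mod 2 * r)" by (rule semidirectE) simp
  have *: "[p ^ 0 * x + u = p ^ j * x + v] (mod (q - 1))" for x using v(1) gam_eq_iff by blast
  have uv: "[u = v] (mod (q - 1))" using *[of 0] by simp
  have "[1 + u = p ^ j + u] (mod (q - 1))"
    using cong_trans[OF *[of 1] cong_add[OF cong_refl cong_sym[OF uv]]] by simp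
  then have "[1 = p ^ j] (mod (q - 1))" by (simp only: cong_add_rcancel_nat)
  then have "[p ^ j = 1] (mod r)"
    using cong_dvd_modulus_nat[OF cong_sym dvd_mult_right[OF assms(3)]] by blast
  then have "r - 1 dvd j" using assms(4) by (simp add: ord_divides')
  moreover have "even (r - 1)" using assms(1) by simp
  ultimately have "even j" using dvd_trans by blast
  moreover have "[geo p j = j] (mod 2)"
    using assms(2) by (intro geo_cong_1) (simp add: cong_def odd_iff_mod_2_eq_one)
  ultimately have "even (geo p j)" using cong_dvd_iff by blast
  then have "2 * r dvd r * geo p j" by (simp add: mult.commute)
  then have "2 * r dvd v" using v(2) cong_dvd_iff by blast
  then show "2 * r dvd u" using cong_dvd_modulus_nat[OF uv assms(3)] cong_dvd_iff by blast
next
  assume "2 * r dvd u"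
  then show "gam 0 u \<in> semidirect (2 * r) 1 r"
    using semidirectI[of u r 1 0 "2 * r"] by (simp add: cong_0_iff)
qed

text \<open>Conjugation in \<open>GammaL1 p\<close> preserves which scalings occur, so they can be
  read off from the listed group.\<close>

lemma listed_scalings:
  assumes H: "subgroup H Perm" and r: "r \<in> prime_factors (q - 1)" and L: "listed i r H"
  shows "gam 0 u \<in> H \<longleftrightarrow> (if i = 3 then r\<^sup>2 else if i = 4 then 2 * r else r) dvd u"
proof -
  have rq: "r dvd q - 1" and pr: "prime r" using r by auto
  from L consider "i = 1" "conjugate_in (GammaL1 p) H (semidirect r 1 0)"
    | "i = 2" "conjugate_in (GammaL1 p) H (semidirect r 2 0)"
    | "i = 3" "r\<^sup>2 dvd q - 1" "conjugate_in (GammaL1 p) H (semidirect (r\<^sup>2) 1 0)"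
    | "i = 4" "odd r" "odd p" "ord r p = r - 1" "2 * r dvd q - 1"
      "conjugate_in (GammaL1 p) H (semidirect (2 * r) 1 r)"
  proof -
    have d: "odd r \<and> 2 * r dvd q - 1" if "odd p" "r \<noteq> 2"
    proof -
      have "odd r" using primes_dvd_imp_eq[OF two_is_prime_nat pr] that(2) by blast
      moreover have "even (q - 1)" using that(1) card_power q1_pos by auto
      ultimately show ?thesis using rq by (auto intro!: divides_mult simp: coprime_left_2_iff_odd)
    qed
    show ?thesis using L that d rq unfolding listed_def by (auto simp: generate_listed)
  qed
  then show ?thesis
  proof cases
    case 1
    then show ?thesis using conjugate_scalings[OF H 1(2) rq scalings_semidirect_0[OF rq]] by simp
  next
    case 2
    then show ?thesis using conjugate_scalings[OF H 2(2) rq scalings_semidirect_0[OF rq]] by simp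
  next
    case 3
    then show ?thesis using conjugate_scalings[OF H 3(3,2) scalings_semidirect_0[OF 3(2)]] by simp
  next
    case 4
    then show ?thesis
      using conjugate_scalings[OF H 4(6,5) scalings_semidirect_double[OF 4(2,3,5,4)]] by simp
  qed
qed

text \<open>The scalings in \<open>H\<close> determine \<open>r\<close>, its square or
  \<open>2 * r\<close>, according to the type. Only types 1 and 2 give a prime, and they differ in
  the order of \<open>p\<close>. A square of a prime equal to twice a prime forces both primes to be
  2, which type 4 excludes.\<close>

lemma listed_unique:
  assumes H: "subgroup H Perm" and r: "r \<in> prime_factors (q - 1)" "r' \<in> prime_factors (q - 1)"
    and L: "listed i r H" "listed i' r' H"
  shows "i = i' \<and> r = r'"
proof -
  let ?M = "\<lambda>i r :: nat. if i = 3 then r\<^sup>2 else if i = (4 :: nat) then 2 * r else r"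
  have "?M i r dvd u \<longleftrightarrow> ?M i' r' dvd u" for u
    by (rule trans[OF listed_scalings[OF H r(1) L(1), symmetric] listed_scalings[OF H r(2) L(2)]])
  then have M: "?M i r = ?M i' r'" using dvd_antisym dvd_refl by blast
  have pr: "prime r" "prime r'" using r by auto
  have square: "\<not> prime (x\<^sup>2)" "\<not> prime (2 * x)" if "prime x" for x :: nat
    using prime_product[of x x] prime_product[of 2 x] prime_gt_1_nat[OF that]
    by (auto simp: power2_eq_square)
  have two: "x = 2 \<and> y = 2" if "x\<^sup>2 = 2 * y" "prime x" "prime y" for x y :: nat
  proof -
    have "even (x\<^sup>2)" using that(1) by simp
    then have "2 dvd x" by simp
    then have "x = 2" using primes_dvd_imp_eq[OF two_is_prime_nat that(2)] by simp
    then show ?thesis using that(1) by simp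
  qed
  have c: "i \<in> {1, 2, 3, 4}" "i' \<in> {1, 2, 3, 4}" using L unfolding listed_def by auto
  have four: "r \<noteq> 2" if "i = 4" using L(1) that unfolding listed_def by simp
  have four': "r' \<noteq> 2" if "i' = 4" using L(2) that unfolding listed_def by simp
  have half: "(x - 1) div 2 \<noteq> x - 1" if "prime x" for x :: nat
    using prime_gt_1_nat[OF that] by simp
  have o: "ord r p = (r - 1) div 2" if "i = 1" using L(1) that unfolding listed_def by simp
  have o': "ord r' p = (r' - 1) div 2" if "i' = 1" using L(2) that unfolding listed_def by simp
  have oo: "ord r p = r - 1" if "i = 2" using L(1) that unfolding listed_def by simp
  have oo': "ord r' p = r' - 1" if "i' = 2" using L(2) that unfolding listed_def by simp
  have "i \<le> 2 \<or> i = 3 \<or> i = 4" "i' \<le> 2 \<or> i' = 3 \<or> i' = 4" using c by auto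
  then consider "i \<le> 2" "i' \<le> 2" | "i = 3" "i' = 3" | "i = 4" "i' = 4"
    | "i \<le> 2" "i' = 3 \<or> i' = 4" | "i = 3 \<or> i = 4" "i' \<le> 2"
    | "i = 3" "i' = 4" | "i = 4" "i' = 3" by blast
  then show ?thesis
  proof cases
    case 1
    then have "r = r'" using M by simp
    then show ?thesis using 1 c o o' oo oo' half[OF pr(1)] by auto
  next
    case 4
    have "?M i r = r" using 4(1) by simp
    moreover have "?M i' r' = r'\<^sup>2 \<or> ?M i' r' = 2 * r'" using 4(2) by auto
    ultimately have "r = r'\<^sup>2 \<or> r = 2 * r'" using M by presburger
    then show ?thesis using square[OF pr(2)] pr(1) by blast
  next
    case 5
    have "?M i' r' = r'" using 5(2) by simp
    moreover have "?M i r = r\<^sup>2 \<or> ?M i r = 2 * r" using 5(1) by auto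
    ultimately have "r' = r\<^sup>2 \<or> r' = 2 * r" using M by presburger
    then show ?thesis using square[OF pr(1)] pr(2) by blast
  next
    case 6
    then show ?thesis using two[of r r'] M pr four' by simp
  next
    case 7
    then show ?thesis using two[of r' r] M pr four by simp
  qed (use M in simp_all)
qed

end

theorem theorem9p4:
  fixes w :: "'a::{field,finite}" and p d q :: nat and G G0 :: "('a \<Rightarrow> 'a) set"
  assumes "prime p" and "q = p ^ d" and "CARD('a) = q"
    and "primitive_element w"
    and "maximal_rank4_affine p G"
    and "G0 = point_stabilizer G 0"
  shows "\<exists>!(i::nat, r)\<in>{1..4} \<times> prime_factors (q - 1).
    (i = 1 \<and> r \<noteq> 2 \<and> ord r p = (r - 1) div 2 \<and>
       conjugate_in (GammaL1 p) G0 (generate Perm {frob p, scaling (w ^ r)})) \<or>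
    (i = 2 \<and> r \<noteq> 2 \<and> ord r p = r - 1 \<and>
       conjugate_in (GammaL1 p) G0 (generate Perm {frob p [^]\<^bsub>Perm\<^esub> (2::nat), scaling (w ^ r)})) \<or>
    (i = 3 \<and> r\<^sup>2 dvd q - 1 \<and> ord (r\<^sup>2) p = r\<^sup>2 - r \<and>
       conjugate_in (GammaL1 p) G0 (generate Perm {frob p, scaling (w ^ r\<^sup>2)})) \<or>
    (i = 4 \<and> odd p \<and> r \<noteq> 2 \<and> ord r p = r - 1 \<and>
       conjugate_in (GammaL1 p) G0
         (generate Perm {scaling (w ^ r) \<otimes>\<^bsub>Perm\<^esub> frob p, scaling (w ^ (2 * r))}))"
proof -
  interpret primitive_root w p q
    using assms(1-4) by unfold_locales auto
  have sub: "subgroup G0 Perm"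
    using assms(5) unfolding assms(6) maximal_rank4_affine_def one_dim_affine_def
    by (intro subgroup_point_stabilizer) simp
  obtain i r where ir: "i \<in> {1..4}" "r \<in> prime_factors (q - 1)" "listed i r G0"
    using listed_exists[OF assms(5)] unfolding assms(6) by blast
  have "\<exists>!(i, r). (i, r) \<in> {1..4} \<times> prime_factors (q - 1) \<and> listed i r G0"
  proof (rule ex1I[of _ "(i, r)"])
    fix y assume "case y of (i, r) \<Rightarrow> (i, r) \<in> {1..4} \<times> prime_factors (q - 1) \<and> listed i r G0"
    then show "y = (i, r)" using listed_unique[OF sub _ ir(2) _ ir(3)] by (cases y) auto
  qed (use ir in simp)
  then show ?thesis unfolding listed_def by (simp add: case_prod_unfold)
qed

end
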